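(* Let $\mathbb{P}$ be a lop-frame in the effective topos $\mathcal{E}\!f\!f$ and $j$ a non-degenerate local operator in $\mathcal{E}\!f\!f$. Then for any $\mathcal{L}_{\mathrm{Arith}}$-formula $\varphi[\vec x]$ and any list $\vec n$ of natural numbers, $\mathcal{E}\!f\!f\models\big(j\Vdash_{\mathbb{P}}(\varphi[\vec n])\big)$ if and only if $\mathrm{R}^{\mathbb{P}}_j(\varphi)(\vec n)\neq\emptyset$, where $\varphi[\vec n]$ is obtained by substituting numerals $\vec n$.
   Context: Realizability notation: fix a primitive recursive pairing $\langle\cdot,\cdot\rangle$ on $\mathbb{N}$; $e\cdot n$ is the $e$-th partial computable function applied to $n$. For subsets (or set-indexed families of subsets) $p,q\subseteq\mathbb{N}$: $p\wedge q:=\{\langle a,b\rangle\mid a\in p,b\in q\}$, $p\vee q:=\{\langle0,a\rangle\mid a\in p\}\cup\{\langle1,b\rangle\mid b\in q\}$, $p\to q:=\{e\mid\forall a\in p\,(e\cdot a\downarrow\text{ and }e\cdot a\in q)\}$, $p\leftrightarrow q:=(p\to q)\wedge(q\to p)$; for functions $\Phi,\Psi:Y\to\mathcal{P}(\mathbb{N})$, $(\Phi\sqsubseteq\Psi):=\bigcap_y(\Phi(y)\to\Psi(y))$, $(\Phi\equiv\Psi):=\bigcap_y(\Phi(y)\leftrightarrow\Psi(y))$; a set is realizable if nonempty. A local operator in $\mathcal{E}\!f\!f$ is a function $j:\mathcal{P}(\mathbb{N})\to\mathcal{P}(\mathbb{N})$ such that $\mathrm{islop}(j):=\bigcap_p(p\to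 j(p))\wedge\bigcap_p(j(j(p))\to j(p))\wedge\bigcap_{p,q}((p\to q)\to(j(p)\to j(q)))$ is nonempty; it is non-degenerate iff it is not $\equiv$-equivalent (realizably) to the constant $\mathbb{N}$, equivalently $j(p)\neq\emptyset\iff p\neq\emptyset$. A lop-frame in $\mathcal{E}\!f\!f$ is a function $\mathbb{P}:\mathcal{P}(\mathbb{N})^{\mathcal{P}(\mathbb{N})}\to\mathcal{P}(\mathbb{N})$ such that $\bigcap_{j,k}(\mathbb{P}(j)\wedge(j\equiv k)\to\mathbb{P}(k))\neq\emptyset$ and $\bigcap_j(\mathbb{P}(j)\to\mathrm{islop}(j))\neq\emptyset$. Such $j$ and $\mathbb{P}$ correspond to closed terms of types $P\Omega$ and $P(P\Omega)$ in the internal language of $\mathcal{E}\!f\!f$ (with $\mathbb{P}\subseteq\mathrm{Lop}$ and $k\in\mathbb{P}$ interpreted as $\mathbb{P}(k)$), through which the internal formula below is evaluated. $\mathcal{L}_{\mathrm{Arith}}$ has $0$, successor and symbols for all primitive recursive functions; formulas are interpreted in $\mathcal{E}\!f\!f$ with variables ranging over the natural numbers object. $\mathbb{P}$-realizability: for an $\mathcal{L}_{\mathrm{Arith}}$-formula $\varphi[\vec x]$ and any $j:\mathcal{P}(\mathbb{N})\to\mathcal{P}(\mathbb{N})$ define $\mathrm{R}^{\mathbb{P}}_j(\varphi):\mathbb{N}^m\to\mathcal{P}(\mathbb{N})$: for atomic $t=s$, $\mathbb{N}$ if true in $\mathbb{N}$ at $\vec n$, else $\emptyset$ ($\bot$ gives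 $\emptyset$); $\mathrm{R}^{\mathbb{P}}_j(\varphi\wedge\psi):=\mathrm{R}^{\mathbb{P}}_j(\varphi)\wedge\mathrm{R}^{\mathbb{P}}_j(\psi)$; $\mathrm{R}^{\mathbb{P}}_j(\varphi\vee\psi):=\mathrm{R}^{\mathbb{P}}_j(\varphi)\vee\mathrm{R}^{\mathbb{P}}_j(\psi)$; $\mathrm{R}^{\mathbb{P}}_j(\varphi\to\psi):=\bigcap_{k}\big(\mathbb{P}(k)\wedge(j\sqsubseteq k)\wedge\mathrm{R}^{\mathbb{P}}_k(\varphi)\to k(\mathrm{R}^{\mathbb{P}}_k(\psi))\big)$; $\mathrm{R}^{\mathbb{P}}_j(\exists y.\varphi)(\vec n):=\bigcup_m(\{m\}\wedge\mathrm{R}^{\mathbb{P}}_j(\varphi)(\vec n,m))$; $\mathrm{R}^{\mathbb{P}}_j(\forall y.\varphi)(\vec n):=\bigcap_k\bigcap_m\big(\mathbb{P}(k)\wedge(j\sqsubseteq k)\wedge\{m\}\to k(\mathrm{R}^{\mathbb{P}}_k(\varphi)(\vec n,m))\big)$, with $k$ ranging over $\mathcal{P}(\mathbb{N})^{\mathcal{P}(\mathbb{N})}$. Internal translation $j\Vdash_{\mathbb{P}}\varphi$ (for $j:P\Omega$, $\mathbb{P}:P(P\Omega)$, writing $jp$ for $p\in j$, $j\le k:=\forall p(jp\to kp)$, $\forall k\ge_{\mathbb{P}}j.\chi:=\forall k(k\in\mathbb{P}\to(j\le k\to\chi))$): $j\Vdash_{\mathbb{P}}R:=jR$; $\wedge$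 componentwise; $j\Vdash_{\mathbb{P}}(\varphi\vee\psi):=j((j\Vdash_{\mathbb{P}}\varphi)\vee(j\Vdash_{\mathbb{P}}\psi))$; $j\Vdash_{\mathbb{P}}(\varphi\to\psi):=\forall k\ge_{\mathbb{P}}j.((k\Vdash_{\mathbb{P}}\varphi)\to(k\Vdash_{\mathbb{P}}\psi))$; $j\Vdash_{\mathbb{P}}\exists y.\varphi:=j(\exists y.\,j\Vdash_{\mathbb{P}}\varphi)$; $j\Vdash_{\mathbb{P}}\forall y.\varphi:=\forall k\ge_{\mathbb{P}}j\,\forall y.\,k\Vdash_{\mathbb{P}}\varphi$. $\mathcal{E}\!f\!f\models\psi$ means the internal sentence $\psi$ holds in $\mathcal{E}\!f\!f$. *)

theory Defs
  imports Main "HOL-Library.Nat_Bijection"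
begin

section \<open>Partial computable functions\<close>

text \<open>
  The pairing on the natural numbers is Cantor's pairing \<open>prod_encode\<close>, which is a
  primitive recursive bijection.  The unary partial computable functions are generated from
  zero, successor and the two projections by pairing, composition, primitive recursion (with
  parameter and recursion argument paired) and unbounded search.
\<close>

abbreviation pair :: "nat \<Rightarrow> nat \<Rightarrow> nat" where
  "pair a b \<equiv> prod_encode (a, b)"

datatype code =
    CZero
  | CSucc
  | CFst
  | CSnd
  | CPair code code
  | CComp code code
  | CPrec code code
  | CMu code

primrec eval :: "code \<Rightarrow> nat \<Rightarrow> nat option" where
  "eval CZero x = Some 0"
| "eval CSucc x = Some (Suc x)"
| "eval CFst x = Some (fst (prod_decode x))"
| "eval CSnd x = Some (snd (prod_decode x))"
| "eval (CPair f g) x =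
     Option.bind (eval f x) (\<lambda>a. Option.bind (eval g x) (\<lambda>b. Some (pair a b)))"
| "eval (CComp f g) x = Option.bind (eval g x) (eval f)"
| "eval (CPrec f g) z =
     (let x = fst (prod_decode z); n = snd (prod_decode z)
      in rec_nat (eval f x) (\<lambda>m r. Option.bind r (\<lambda>v. eval g (pair x (pair m v)))) n)"
| "eval (CMu f) x =
     (if \<exists>n. eval f (pair x n) = Some 0 \<and> (\<forall>m<n. \<exists>v. eval f (pair x m) = Some (Suc v))
      then Some (LEAST n. eval f (pair x n) = Some 0) else None)"

text \<open>
  The numbering: the indices 0 to 3 stand for the basic functions; for larger indices the
  remainder modulo 4 selects the constructor and the quotient codes its arguments.
\<close>

function decode :: "nat \<Rightarrow> code" where
  "decode e =
     (if e = 0 then CZero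
      else if e = 1 then CSucc
      else if e = 2 then CFst
      else if e = 3 then CSnd
      else
        let q = (e - 4) div 4; a = fst (prod_decode q); b = snd (prod_decode q)
        in if e mod 4 = 0 then CPair (decode a) (decode b)
           else if e mod 4 = 1 then CComp (decode a) (decode b)
           else if e mod 4 = 2 then CPrec (decode a) (decode b)
           else CMu (decode q))"
  by pat_completeness auto

lemma fst_prod_decode_le: "fst (prod_decode q) \<le> q"
  by (metis le_prod_encode_1 prod.collapse prod_decode_inverse)

lemma snd_prod_decode_le: "snd (prod_decode q) \<le> q"
  by (metis le_prod_encode_2 prod.collapse prod_decode_inverse)

lemma decode_arg_less:
  assumes "e \<noteq> 0" "e \<noteq> 1" "e \<noteq> 2" "e \<noteq> 3"
  shows "(e - 4) div 4 < (e::nat)"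
  using assms by linarith

termination decode
  by (relation "measure id")
    (use decode_arg_less fst_prod_decode_le snd_prod_decode_le in
      \<open>auto intro: le_less_trans simp del: One_nat_def\<close>)

declare decode.simps [simp del]

lemma decode_binary:
  "decode (4 + 4 * pair a b) = CPair (decode a) (decode b)"
  "decode (5 + 4 * pair a b) = CComp (decode a) (decode b)"
  "decode (6 + 4 * pair a b) = CPrec (decode a) (decode b)"
  "decode (7 + 4 * q) = CMu (decode q)"
proof -
  have m: "(4 + 4 * n) mod 4 = 0" "(5 + 4 * n) mod 4 = 1" "(6 + 4 * n) mod 4 = 2"
    "(7 + 4 * n) mod 4 = 3" "(4 + 4 * n - 4) div 4 = n" "(5 + 4 * n - 4) div 4 = n"
    "(6 + 4 * n - 4) div 4 = n" "(7 + 4 * n - 4) div 4 = n" for n :: nat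
    by presburger+
  show "decode (4 + 4 * pair a b) = CPair (decode a) (decode b)"
    by (subst decode.simps) (simp only: m Let_def prod_encode_inverse fst_conv snd_conv, simp)
  show "decode (5 + 4 * pair a b) = CComp (decode a) (decode b)"
    by (subst decode.simps) (simp only: m Let_def prod_encode_inverse fst_conv snd_conv, simp)
  show "decode (6 + 4 * pair a b) = CPrec (decode a) (decode b)"
    by (subst decode.simps) (simp only: m Let_def prod_encode_inverse fst_conv snd_conv, simp)
  show "decode (7 + 4 * q) = CMu (decode q)"
    by (subst decode.simps) (simp only: m Let_def, simp)
qed

lemma decode_surj: "\<exists>e. decode e = c"
proof (induction c)
  case CZero
  show ?case by (rule exI[of _ 0]) (simp add: decode.simps)
next
  case CSucc
  show ?case by (rule exI[of _ 1]) (simp add: decode.simps)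
next
  case CFst
  show ?case by (rule exI[of _ 2]) (simp add: decode.simps)
next
  case CSnd
  show ?case by (rule exI[of _ 3]) (simp add: decode.simps)
qed (use decode_binary in metis)+

definition app :: "nat \<Rightarrow> nat \<Rightarrow> nat option" where
  "app e n = eval (decode e) n"


section \<open>Realizability connectives\<close>

definition rconj :: "nat set \<Rightarrow> nat set \<Rightarrow> nat set" (infixr "\<^bold>\<and>" 35) where
  "(p \<^bold>\<and> q) = {pair a b | a b. a \<in> p \<and> b \<in> q}"

definition rdisj :: "nat set \<Rightarrow> nat set \<Rightarrow> nat set" (infixr "\<^bold>\<or>" 30) where
  "(p \<^bold>\<or> q) = {pair 0 a | a. a \<in> p} \<union> {pair 1 b | b. b \<in> q}"

definition rimp :: "nat set \<Rightarrow> nat set \<Rightarrow> nat set" (infixr "\<^bold>\<longrightarrow>" 25) where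
  "(p \<^bold>\<longrightarrow> q) = {e. \<forall>a\<in>p. \<exists>b\<in>q. app e a = Some b}"

definition riff :: "nat set \<Rightarrow> nat set \<Rightarrow> nat set" (infixr "\<^bold>\<longleftrightarrow>" 25) where
  "(p \<^bold>\<longleftrightarrow> q) = ((p \<^bold>\<longrightarrow> q) \<^bold>\<and> (q \<^bold>\<longrightarrow> p))"

definition rsub :: "('a \<Rightarrow> nat set) \<Rightarrow> ('a \<Rightarrow> nat set) \<Rightarrow> nat set" (infix "\<^bold>\<sqsubseteq>" 50) where
  "(\<Phi> \<^bold>\<sqsubseteq> \<Psi>) = (\<Inter>y. \<Phi> y \<^bold>\<longrightarrow> \<Psi> y)"

definition req :: "('a \<Rightarrow> nat set) \<Rightarrow> ('a \<Rightarrow> nat set) \<Rightarrow> nat set" (infix "\<^bold>\<equiv>" 50) where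
  "(\<Phi> \<^bold>\<equiv> \<Psi>) = (\<Inter>y. \<Phi> y \<^bold>\<longleftrightarrow> \<Psi> y)"


section \<open>Local operators and lop-frames\<close>

type_synonym lop = "nat set \<Rightarrow> nat set"
type_synonym frame = "lop \<Rightarrow> nat set"

definition islop :: "lop \<Rightarrow> nat set" where
  "islop j =
     ((\<Inter>p. p \<^bold>\<longrightarrow> j p) \<^bold>\<and>
      (\<Inter>p. j (j p) \<^bold>\<longrightarrow> j p) \<^bold>\<and>
      (\<Inter>p q. (p \<^bold>\<longrightarrow> q) \<^bold>\<longrightarrow> (j p \<^bold>\<longrightarrow> j q)))"

definition local_operator :: "lop \<Rightarrow> bool" where
  "local_operator j \<longleftrightarrow> islop j \<noteq> {}"

definition nondegenerate :: "lop \<Rightarrow> bool" where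
  "nondegenerate j \<longleftrightarrow> (j \<^bold>\<equiv> (\<lambda>_. UNIV)) = {}"

definition lop_frame :: "frame \<Rightarrow> bool" where
  "lop_frame P \<longleftrightarrow>
     (\<Inter>j k. (P j \<^bold>\<and> (j \<^bold>\<equiv> k)) \<^bold>\<longrightarrow> P k) \<noteq> {} \<and>
     (\<Inter>j. P j \<^bold>\<longrightarrow> islop j) \<noteq> {}"


section \<open>The language of arithmetic\<close>

text \<open>
  Definitions of primitive recursive functions.  They carry no arity of their own:
  \<open>prf_arity f n\<close> says that \<open>f\<close> defines an \<open>n\<close>-ary function.  In \<open>PRec f g\<close> the recursion
  argument comes first.
\<close>

datatype prfn =
    PZero
  | PSucc
  | PProj nat
  | PComp prfn "prfn list"
  | PRec prfn prfn

fun prf_arity :: "prfn \<Rightarrow> nat \<Rightarrow> bool" where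
  "prf_arity PZero n \<longleftrightarrow> True"
| "prf_arity PSucc n \<longleftrightarrow> n = 1"
| "prf_arity (PProj i) n \<longleftrightarrow> i < n"
| "prf_arity (PComp f gs) n \<longleftrightarrow> prf_arity f (length gs) \<and> (\<forall>g\<in>set gs. prf_arity g n)"
| "prf_arity (PRec f g) n \<longleftrightarrow> n \<noteq> 0 \<and> prf_arity f (n - 1) \<and> prf_arity g (n + 1)"

fun prf_eval :: "prfn \<Rightarrow> nat list \<Rightarrow> nat" where
  "prf_eval PZero xs = 0"
| "prf_eval PSucc xs = Suc (hd xs)"
| "prf_eval (PProj i) xs = xs ! i"
| "prf_eval (PComp f gs) xs = prf_eval f (map (\<lambda>g. prf_eval g xs) gs)"
| "prf_eval (PRec f g) xs =
     rec_nat (prf_eval f (tl xs)) (\<lambda>m r. prf_eval g (m # r # tl xs)) (hd xs)"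

text \<open>Variables are de Bruijn indices; the value of variable \<open>i\<close> is entry \<open>i\<close> of the environment.\<close>

datatype tm =
    Var nat
  | Zero
  | Succ tm
  | Fn prfn "tm list"

fun wf_tm :: "nat \<Rightarrow> tm \<Rightarrow> bool" where
  "wf_tm m (Var i) \<longleftrightarrow> i < m"
| "wf_tm m Zero \<longleftrightarrow> True"
| "wf_tm m (Succ t) \<longleftrightarrow> wf_tm m t"
| "wf_tm m (Fn f ts) \<longleftrightarrow> prf_arity f (length ts) \<and> (\<forall>t\<in>set ts. wf_tm m t)"

fun tm_val :: "nat list \<Rightarrow> tm \<Rightarrow> nat" where
  "tm_val ns (Var i) = ns ! i"
| "tm_val ns Zero = 0"
| "tm_val ns (Succ t) = Suc (tm_val ns t)"
| "tm_val ns (Fn f ts) = prf_eval f (map (tm_val ns) ts)"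

datatype fm =
    Bot
  | Eq tm tm
  | And fm fm
  | Or fm fm
  | Imp fm fm
  | All fm
  | Ex fm

text \<open>\<open>wf_fm m \<phi>\<close>: the free variables of \<open>\<phi>\<close> are among the first \<open>m\<close> ones.\<close>

primrec wf_fm :: "nat \<Rightarrow> fm \<Rightarrow> bool" where
  "wf_fm m Bot \<longleftrightarrow> True"
| "wf_fm m (Eq t s) \<longleftrightarrow> wf_tm m t \<and> wf_tm m s"
| "wf_fm m (And \<phi> \<psi>) \<longleftrightarrow> wf_fm m \<phi> \<and> wf_fm m \<psi>"
| "wf_fm m (Or \<phi> \<psi>) \<longleftrightarrow> wf_fm m \<phi> \<and> wf_fm m \<psi>"
| "wf_fm m (Imp \<phi> \<psi>) \<longleftrightarrow> wf_fm m \<phi> \<and> wf_fm m \<psi>"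
| "wf_fm m (All \<phi>) \<longleftrightarrow> wf_fm (Suc m) \<phi>"
| "wf_fm m (Ex \<phi>) \<longleftrightarrow> wf_fm (Suc m) \<phi>"

primrec numeral_tm :: "nat \<Rightarrow> tm" where
  "numeral_tm 0 = Zero"
| "numeral_tm (Suc n) = Succ (numeral_tm n)"

text \<open>
  Substitution of numerals for the free variables, below \<open>d\<close> binders.  Numerals are closed, so
  nothing has to be lifted.
\<close>

fun inst_tm :: "nat \<Rightarrow> nat list \<Rightarrow> tm \<Rightarrow> tm" where
  "inst_tm d ns (Var i) = (if i < d then Var i else numeral_tm (ns ! (i - d)))"
| "inst_tm d ns Zero = Zero"
| "inst_tm d ns (Succ t) = Succ (inst_tm d ns t)"
| "inst_tm d ns (Fn f ts) = Fn f (map (inst_tm d ns) ts)"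

primrec inst_fm :: "nat \<Rightarrow> nat list \<Rightarrow> fm \<Rightarrow> fm" where
  "inst_fm d ns Bot = Bot"
| "inst_fm d ns (Eq t s) = Eq (inst_tm d ns t) (inst_tm d ns s)"
| "inst_fm d ns (And \<phi> \<psi>) = And (inst_fm d ns \<phi>) (inst_fm d ns \<psi>)"
| "inst_fm d ns (Or \<phi> \<psi>) = Or (inst_fm d ns \<phi>) (inst_fm d ns \<psi>)"
| "inst_fm d ns (Imp \<phi> \<psi>) = Imp (inst_fm d ns \<phi>) (inst_fm d ns \<psi>)"
| "inst_fm d ns (All \<phi>) = All (inst_fm (Suc d) ns \<phi>)"
| "inst_fm d ns (Ex \<phi>) = Ex (inst_fm (Suc d) ns \<phi>)"

abbreviation subst_numerals :: "fm \<Rightarrow> nat list \<Rightarrow> fm" where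
  "subst_numerals \<phi> ns \<equiv> inst_fm 0 ns \<phi>"


section \<open>Realizability over a lop-frame\<close>

primrec rlz :: "frame \<Rightarrow> fm \<Rightarrow> lop \<Rightarrow> nat list \<Rightarrow> nat set" where
  "rlz P Bot j ns = {}"
| "rlz P (Eq t s) j ns = (if tm_val ns t = tm_val ns s then UNIV else {})"
| "rlz P (And \<phi> \<psi>) j ns = (rlz P \<phi> j ns \<^bold>\<and> rlz P \<psi> j ns)"
| "rlz P (Or \<phi> \<psi>) j ns = (rlz P \<phi> j ns \<^bold>\<or> rlz P \<psi> j ns)"
| "rlz P (Imp \<phi> \<psi>) j ns =
     (\<Inter>k. (P k \<^bold>\<and> (j \<^bold>\<sqsubseteq> k) \<^bold>\<and> rlz P \<phi> k ns) \<^bold>\<longrightarrow> k (rlz P \<psi> k ns))"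
| "rlz P (All \<phi>) j ns =
     (\<Inter>k. \<Inter>m. (P k \<^bold>\<and> (j \<^bold>\<sqsubseteq> k) \<^bold>\<and> {m}) \<^bold>\<longrightarrow> k (rlz P \<phi> k (m # ns)))"
| "rlz P (Ex \<phi>) j ns = (\<Union>m. {m} \<^bold>\<and> rlz P \<phi> j (m # ns))"


section \<open>The internal language of the effective topos\<close>

text \<open>
  An object of the effective topos is a set with an equality valued in sets of natural numbers;
  \<open>eq x x\<close> is the existence predicate.  The natural numbers object, the object of truth values
  and power objects are presented as usual; the elements of a power object exist insofar as they
  are extensional and strict.
\<close>

definition eqN :: "nat \<Rightarrow> nat \<Rightarrow> nat set" where
  "eqN m n = {m} \<inter> {n}"

definition eqOmega :: "nat set \<Rightarrow> nat set \<Rightarrow> nat set" where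
  "eqOmega p q = (p \<^bold>\<longleftrightarrow> q)"

definition eqPow :: "('a \<Rightarrow> 'a \<Rightarrow> nat set) \<Rightarrow> ('a \<Rightarrow> nat set) \<Rightarrow> ('a \<Rightarrow> nat set) \<Rightarrow> nat set" where
  "eqPow eq R S =
     ((\<Inter>x y. (R x \<^bold>\<and> eq x y) \<^bold>\<longrightarrow> R y) \<^bold>\<and> (\<Inter>x. R x \<^bold>\<longrightarrow> eq x x) \<^bold>\<and> (R \<^bold>\<equiv> S))"

abbreviation eqPOmega :: "lop \<Rightarrow> lop \<Rightarrow> nat set" where
  "eqPOmega \<equiv> eqPow eqOmega"

definition forall_in :: "('a \<Rightarrow> 'a \<Rightarrow> nat set) \<Rightarrow> ('a \<Rightarrow> nat set) \<Rightarrow> nat set" where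
  "forall_in eq \<Phi> = (\<Inter>x. eq x x \<^bold>\<longrightarrow> \<Phi> x)"

definition exists_in :: "('a \<Rightarrow> 'a \<Rightarrow> nat set) \<Rightarrow> ('a \<Rightarrow> nat set) \<Rightarrow> nat set" where
  "exists_in eq \<Phi> = (\<Union>x. eq x x \<^bold>\<and> \<Phi> x)"

text \<open>
  The fragment of the internal higher-order language with variables of the types \<open>N\<close>, \<open>\<Omega>\<close>
  and \<open>P\<Omega>\<close>, each type with its own de Bruijn indices.  Terms of type \<open>N\<close> are the arithmetical
  terms, and terms of type \<open>\<Omega>\<close> are the formulas.  The closed terms of types \<open>P\<Omega>\<close> and
  \<open>P(P\<Omega>)\<close> are named by the functions representing them; this is meaningful only for functions
  that are realizably extensional and strict, as local operators and lop-frames are.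
  \<open>IHolds j p\<close> is the membership of \<open>p\<close> in \<open>j\<close>, written \<open>jp\<close>.
\<close>

datatype potm =
    POVar nat
  | POConst lop

datatype ifm =
    IBot
  | IEq tm tm
  | IVar nat
  | IHolds potm ifm
  | IMem potm frame
  | IAnd ifm ifm
  | IOr ifm ifm
  | IImp ifm ifm
  | IAllN ifm
  | IExN ifm
  | IAllOmega ifm
  | IExOmega ifm
  | IAllPOmega ifm
  | IExPOmega ifm

primrec po_val :: "lop list \<Rightarrow> potm \<Rightarrow> lop" where
  "po_val ks (POVar i) = ks ! i"
| "po_val ks (POConst j) = j"

primrec interp :: "ifm \<Rightarrow> nat list \<Rightarrow> nat set list \<Rightarrow> lop list \<Rightarrow> nat set" where
  "interp IBot ns ps ks = {}"
| "interp (IEq t s) ns ps ks = eqN (tm_val ns t) (tm_val ns s)"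
| "interp (IVar i) ns ps ks = ps ! i"
| "interp (IHolds j \<phi>) ns ps ks = po_val ks j (interp \<phi> ns ps ks)"
| "interp (IMem k P) ns ps ks = P (po_val ks k)"
| "interp (IAnd \<phi> \<psi>) ns ps ks = (interp \<phi> ns ps ks \<^bold>\<and> interp \<psi> ns ps ks)"
| "interp (IOr \<phi> \<psi>) ns ps ks = (interp \<phi> ns ps ks \<^bold>\<or> interp \<psi> ns ps ks)"
| "interp (IImp \<phi> \<psi>) ns ps ks = (interp \<phi> ns ps ks \<^bold>\<longrightarrow> interp \<psi> ns ps ks)"
| "interp (IAllN \<phi>) ns ps ks = forall_in eqN (\<lambda>n. interp \<phi> (n # ns) ps ks)"
| "interp (IExN \<phi>) ns ps ks = exists_in eqN (\<lambda>n. interp \<phi> (n # ns) ps ks)"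
| "interp (IAllOmega \<phi>) ns ps ks = forall_in eqOmega (\<lambda>p. interp \<phi> ns (p # ps) ks)"
| "interp (IExOmega \<phi>) ns ps ks = exists_in eqOmega (\<lambda>p. interp \<phi> ns (p # ps) ks)"
| "interp (IAllPOmega \<phi>) ns ps ks = forall_in eqPOmega (\<lambda>k. interp \<phi> ns ps (k # ks))"
| "interp (IExPOmega \<phi>) ns ps ks = exists_in eqPOmega (\<lambda>k. interp \<phi> ns ps (k # ks))"

definition Eff_models :: "ifm \<Rightarrow> bool" where
  "Eff_models \<psi> \<longleftrightarrow> interp \<psi> [] [] [] \<noteq> {}"


section \<open>The internal translation\<close>

primrec lift_po :: "potm \<Rightarrow> potm" where
  "lift_po (POVar i) = POVar (Suc i)"
| "lift_po (POConst j) = POConst j"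

definition ILe :: "potm \<Rightarrow> potm \<Rightarrow> ifm" where
  "ILe j k = IAllOmega (IImp (IHolds j (IVar 0)) (IHolds k (IVar 0)))"

text \<open>Bounded quantification over \<open>k \<ge> j\<close> in \<open>P\<close>; in the body, \<open>k\<close> is \<open>POVar 0\<close>.\<close>

definition IAllGe :: "frame \<Rightarrow> potm \<Rightarrow> ifm \<Rightarrow> ifm" where
  "IAllGe P j \<chi> =
     IAllPOmega (IImp (IMem (POVar 0) P) (IImp (ILe (lift_po j) (POVar 0)) \<chi>))"

primrec forces :: "frame \<Rightarrow> potm \<Rightarrow> fm \<Rightarrow> ifm" where
  "forces P j Bot = IHolds j IBot"
| "forces P j (Eq t s) = IHolds j (IEq t s)"
| "forces P j (And \<phi> \<psi>) = IAnd (forces P j \<phi>) (forces P j \<psi>)"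
| "forces P j (Or \<phi> \<psi>) = IHolds j (IOr (forces P j \<phi>) (forces P j \<psi>))"
| "forces P j (Imp \<phi> \<psi>) =
     IAllGe P j (IImp (forces P (POVar 0) \<phi>) (forces P (POVar 0) \<psi>))"
| "forces P j (All \<phi>) = IAllGe P j (IAllN (forces P (POVar 0) \<phi>))"
| "forces P j (Ex \<phi>) = IHolds j (IExN (forces P j \<phi>))"

end

theory Submission
  imports Defs
begin

text \<open>
  Uniformly in a local operator \<open>j\<close> and the values of the free variables, \<open>j\<close> forces \<open>\<phi>\<close>
  iff \<open>j (R\<^sub>j \<phi>)\<close> is realized: the forcing interpretation puts \<open>j\<close> in front of atoms,
  disjunctions and existential quantifiers, whereas \<open>R\<close> puts it behind implications and universal
  quantifiers, and the monad laws of \<open>j\<close> move it from one place to the other.  For a non-degenerate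
  \<open>j\<close> the outer \<open>j\<close> does not affect inhabitedness.  Uniform realizability obeys the rules of
  intuitionistic logic, so the induction on \<open>\<phi>\<close> is a derivation in that logic; computability enters
  through the s-m-n theorem (implication introduction), a universal function (modus ponens) and the
  computability of terms (realizers of true equations are the values of the terms).
\<close>

section \<open>Computable functions\<close>

abbreviation pfst :: "nat \<Rightarrow> nat" where "pfst x \<equiv> fst (prod_decode x)"
abbreviation psnd :: "nat \<Rightarrow> nat" where "psnd x \<equiv> snd (prod_decode x)"

definition computable :: "(nat \<Rightarrow> nat) \<Rightarrow> bool" where
  "computable f \<longleftrightarrow> (\<exists>c. \<forall>x. eval c x = Some (f x))"

named_theorems comp_intros

lemma computableI: "(\<And>x. eval c x = Some (f x)) \<Longrightarrow> computable f"
  unfolding computable_def by blast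

lemma computable_id [comp_intros]: "computable (\<lambda>x. x)"
  by (rule computableI[of "CPair CFst CSnd"]) simp

lemma computable_Suc [comp_intros]:
  assumes "computable f" shows "computable (\<lambda>x. Suc (f x))"
proof -
  obtain c where "\<forall>x. eval c x = Some (f x)" using assms unfolding computable_def by blast
  then show ?thesis by (intro computableI[of "CComp CSucc c"]) simp
qed

lemma computable_pfst [comp_intros]:
  assumes "computable f" shows "computable (\<lambda>x. pfst (f x))"
proof -
  obtain c where "\<forall>x. eval c x = Some (f x)" using assms unfolding computable_def by blast
  then show ?thesis by (intro computableI[of "CComp CFst c"]) simp
qed

lemma computable_psnd [comp_intros]:
  assumes "computable f" shows "computable (\<lambda>x. psnd (f x))"
proof -
  obtain c where "\<forall>x. eval c x = Some (f x)" using assms unfolding computable_def by blast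
  then show ?thesis by (intro computableI[of "CComp CSnd c"]) simp
qed

lemma computable_pair [comp_intros]:
  assumes "computable f" "computable g" shows "computable (\<lambda>x. pair (f x) (g x))"
proof -
  obtain c d where "\<forall>x. eval c x = Some (f x)" "\<forall>x. eval d x = Some (g x)"
    using assms unfolding computable_def by blast
  then show ?thesis by (intro computableI[of "CPair c d"]) simp
qed

lemma computable_compose:
  assumes "computable f" "computable g" shows "computable (\<lambda>x. f (g x))"
proof -
  obtain c d where "\<forall>x. eval c x = Some (f x)" "\<forall>x. eval d x = Some (g x)"
    using assms unfolding computable_def by blast
  then show ?thesis by (intro computableI[of "CComp c d"]) simp
qed

lemma computable_const [comp_intros]: "computable (\<lambda>_. n)"
proof (induction n)
  case 0
  show ?case by (rule computableI[of CZero]) simp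
qed (rule computable_Suc)

text \<open>The second assumption presents the step function in the shape in which
  \<open>CPrec\<close> calls it: on \<open>pair x (pair m v)\<close> with parameter
  \<open>x\<close>, counter \<open>m\<close> and previous value \<open>v\<close>.\<close>

lemma computable_rec:
  assumes "computable b" "computable (\<lambda>z. h (pfst z) (pfst (psnd z)) (psnd (psnd z)))" "computable n"
  shows "computable (\<lambda>x. rec_nat (b x) (h x) (n x))"
proof -
  obtain c d where c: "\<forall>x. eval c x = Some (b x)"
    and d: "\<forall>z. eval d z = Some (h (pfst z) (pfst (psnd z)) (psnd (psnd z)))"
    using assms unfolding computable_def by blast
  have "rec_nat (eval c x) (\<lambda>m r. Option.bind r (\<lambda>v. eval d (pair x (pair m v)))) k
      = Some (rec_nat (b x) (h x) k)" for x k
    by (induction k) (simp_all add: c d)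
  then have "computable (\<lambda>z. rec_nat (b (pfst z)) (h (pfst z)) (psnd z))"
    by (intro computableI[of "CPrec c d"]) (simp add: Let_def)
  from computable_compose[OF this computable_pair[OF computable_id assms(3)]]
  show ?thesis by simp
qed

lemma computable_add [comp_intros]:
  assumes "computable f" "computable g" shows "computable (\<lambda>x. f x + g x)"
proof -
  have "rec_nat a (\<lambda>_ r. Suc r) n = a + n" for a n
    by (induction n) simp_all
  moreover have "computable (\<lambda>x. rec_nat (f x) (\<lambda>_ r. Suc r) (g x))"
    by (intro computable_rec comp_intros assms)
  ultimately show ?thesis by (simp only:)
qed

lemma computable_diff [comp_intros]:
  assumes "computable f" "computable g" shows "computable (\<lambda>x. f x - g x)"
proof -
  have pred: "rec_nat 0 (\<lambda>m _. m) n = n - Suc 0" for n :: nat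
    by (cases n) simp_all
  have c: "computable (\<lambda>x. x - Suc 0)"
    unfolding pred[symmetric] by (intro computable_rec comp_intros)
  have d: "rec_nat a (\<lambda>_ r. r - Suc 0) n = a - n" for a n
  proof (induction n)
    case (Suc n)
    then show ?case by simp
  qed simp
  have "computable (\<lambda>x. rec_nat (f x) (\<lambda>_ r. r - Suc 0) (g x))"
    by (intro computable_rec comp_intros assms computable_compose[OF c])
  then show ?thesis by (simp only: d)
qed

text \<open>A case distinction is a recursion whose step forgets the previous value: any positive
  number of steps yields \<open>g x\<close>.\<close>

lemma computable_if_zero:
  assumes "computable c" "computable f" "computable g"
  shows "computable (\<lambda>x. if c x = 0 then f x else g x)"
proof -
  have e: "(if n = 0 then f x else g x) = rec_nat (f x) (\<lambda>_ _. g x) n" for n x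
    by (cases n) simp_all
  have "computable (\<lambda>x. rec_nat (f x) (\<lambda>_ _. g x) (c x))"
    by (intro computable_rec comp_intros assms computable_compose[OF assms(3)])
  then show ?thesis by (simp add: e)
qed

lemma computable_if_eq [comp_intros]:
  assumes "computable c" "computable d" "computable f" "computable g"
  shows "computable (\<lambda>x. if c x = d x then f x else g x)"
proof -
  have "(m = n) = ((m - n) + (n - m) = 0)" for m n :: nat by linarith
  then show ?thesis
    using computable_if_zero[of "\<lambda>x. (c x - d x) + (d x - c x)" f g] assms
    by (simp only: computable_add computable_diff)
qed

text \<open>The numbering of codes divides by 4 only. The remainder is a counter that returns to 0
  after 3, and the quotient grows whenever that counter is reset.\<close>

lemma computable_mod_4 [comp_intros]:
  assumes "computable f" shows "computable (\<lambda>x. f x mod 4)"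
proof -
  have e: "n mod 4 = rec_nat 0 (\<lambda>_ r. if r = 3 then 0 else Suc r) n" for n :: nat
  proof (induction n)
    case (Suc n)
    then show ?case by (simp add: mod_Suc)
  qed simp
  have "computable (\<lambda>x. rec_nat 0 (\<lambda>_ r. if r = 3 then 0 else Suc r) (f x))"
    by (intro computable_rec comp_intros assms)
  then show ?thesis by (simp only: e)
qed

lemma computable_div_4 [comp_intros]:
  assumes "computable f" shows "computable (\<lambda>x. f x div 4)"
proof -
  have e: "n div 4 = rec_nat 0 (\<lambda>m r. if m mod 4 = 3 then Suc r else r) n" for n :: nat
  proof (induction n)
    case (Suc n)
    then show ?case by (simp add: div_Suc) presburger
  qed simp
  have "computable (\<lambda>x. rec_nat 0 (\<lambda>m r. if m mod 4 = 3 then Suc r else r) (f x))"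
    by (intro computable_rec comp_intros assms)
  then show ?thesis by (simp only: e)
qed

section \<open>The universal function\<close>

text \<open>
  A state \<open>pair v K\<close> of the abstract machine has a current value \<open>v\<close> and a stack \<open>K\<close> of frames
  \<open>pair t d\<close>.  The frames are: \<open>t = 1\<close>, apply the function with index \<open>d\<close> to \<open>v\<close>; \<open>t = 2\<close> and
  \<open>t = 3\<close>, the first, respectively second, component of a pairing has been computed; \<open>t = 4\<close>, a step
  of a primitive recursion; \<open>t = 5\<close>, a step of an unbounded search.  As \<open>pair 0 0 = 0\<close>, the empty
  stack \<open>0\<close> has the top frame \<open>0\<close> with tag \<open>t = 0\<close>, on which the machine halts.
\<close>

definition eval_step :: "nat \<Rightarrow> nat \<Rightarrow> nat \<Rightarrow> nat" where
  "eval_step e v K =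
    (if e = 0 then pair 0 K
     else if e = 1 then pair (Suc v) K
     else if e = 2 then pair (pfst v) K
     else if e = 3 then pair (psnd v) K
     else if e mod 4 = 0 then
       pair v (pair (pair 1 (pfst ((e - 4) div 4)))
         (pair (pair 2 (pair (psnd ((e - 4) div 4)) v)) K))
     else if e mod 4 = 1 then
       pair v (pair (pair 1 (psnd ((e - 4) div 4))) (pair (pair 1 (pfst ((e - 4) div 4))) K))
     else if e mod 4 = 2 then
       (if psnd v = 0 then pair (pfst v) (pair (pair 1 (pfst ((e - 4) div 4))) K)
        else pair (pair (pfst v) (psnd v - 1)) (pair (pair 1 e)
          (pair (pair 4 (pair (psnd ((e - 4) div 4)) (pair (pfst v) (psnd v - 1)))) K)))
     else pair (pair v 0) (pair (pair 1 ((e - 4) div 4))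
       (pair (pair 5 (pair ((e - 4) div 4) (pair v 0))) K)))"

definition frame_step :: "nat \<Rightarrow> nat \<Rightarrow> nat \<Rightarrow> nat \<Rightarrow> nat" where
  "frame_step t d v K =
    (if t = 0 then pair v (pair (pair t d) K)
     else if t = 1 then eval_step d v K
     else if t = 2 then pair (psnd d) (pair (pair 1 (pfst d)) (pair (pair 3 v) K))
     else if t = 3 then pair (pair d v) K
     else if t = 4 then
       pair (pair (pfst (psnd d)) (pair (psnd (psnd d)) v)) (pair (pair 1 (pfst d)) K)
     else if v = 0 then pair (psnd (psnd d)) K
     else pair (pair (pfst (psnd d)) (Suc (psnd (psnd d))))
       (pair (pair 1 (pfst d))
         (pair (pair 5 (pair (pfst d) (pair (pfst (psnd d)) (Suc (psnd (psnd d)))))) K)))"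

definition step :: "nat \<Rightarrow> nat" where
  "step s = frame_step (pfst (pfst (psnd s))) (psnd (pfst (psnd s))) (pfst s) (psnd (psnd s))"

lemma computable_step: "computable step"
  unfolding step_def frame_step_def eval_step_def by (intro comp_intros)

lemma step_pair: "step (pair v (pair (pair t d) K)) = frame_step t d v K"
  by (simp add: step_def)

text \<open>Halted states are fixed points, so the state at the first halting time is also the state
  at every later time.\<close>

lemma step_halted: "pfst (pfst (psnd s)) = 0 \<Longrightarrow> step s = s"
  unfolding step_def frame_step_def by (simp, metis prod.collapse prod_decode_inverse)

definition reach :: "nat \<Rightarrow> nat \<Rightarrow> bool" where
  "reach s s' \<longleftrightarrow> (\<exists>t. (step ^^ t) s = s')"

lemma reach_refl: "reach s s"
  unfolding reach_def by (rule exI[of _ 0]) simp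

lemma reach_trans: "reach s s' \<Longrightarrow> reach s' s'' \<Longrightarrow> reach s s''"
  unfolding reach_def by (metis funpow_add comp_apply add.commute)

lemma reach_step: "reach (step s) s' \<Longrightarrow> reach s s'"
  unfolding reach_def by (metis funpow_Suc_right comp_apply)

lemma reach_frame: "reach (frame_step t d v K) s' \<Longrightarrow> reach (pair v (pair (pair t d) K)) s'"
  using reach_step[of "pair v (pair (pair t d) K)"] by (simp add: step_pair)

lemma reach_eval: "reach (eval_step e v K) s' \<Longrightarrow> reach (pair v (pair (pair 1 e) K)) s'"
  using reach_frame[of 1 e v K] by (simp add: frame_step_def)

text \<open>Downward induction from the zero \<open>n\<close>: at \<open>n\<close> frame 5 delivers
  the result, and at a smaller \<open>m\<close> the value is positive, so frame 5 starts the test of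
  \<open>m + 1\<close>.\<close>

lemma reach_eval_mu:
  assumes ev: "\<And>x y K. eval (decode q) x = Some y \<Longrightarrow> reach (pair x (pair (pair 1 q) K)) (pair y K)"
    and zero: "eval (decode q) (pair x n) = Some 0"
    and pos: "\<forall>m<n. \<exists>v. eval (decode q) (pair x m) = Some (Suc v)" and "m \<le> n"
  shows "reach (pair (pair x m) (pair (pair 1 q) (pair (pair 5 (pair q (pair x m))) K))) (pair n K)"
  using \<open>m \<le> n\<close>
proof (induction rule: inc_induct)
  case base
  show ?case
    by (rule reach_trans[OF ev[OF zero]], rule reach_frame) (simp add: frame_step_def reach_refl)
next
  case (step m)
  then obtain v where "eval (decode q) (pair x m) = Some (Suc v)" using pos by blast
  from ev[OF this] show ?case
    by (rule reach_trans, intro reach_frame) (simp add: frame_step_def step.IH del: One_nat_def)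
qed

text \<open>A recursive call evaluates the same index \<open>e\<close> at a smaller argument, which
  an induction on indices cannot cover. Hence this separate induction on \<open>n\<close>, with
  \<open>K\<close> arbitrary because the call runs on top of frame 4.\<close>

lemma reach_eval_prec:
  assumes q: "e mod 4 = 2" "e \<ge> 4" "pfst ((e - 4) div 4) = a" "psnd ((e - 4) div 4) = b"
    and eva: "\<And>x y K. eval (decode a) x = Some y \<Longrightarrow> reach (pair x (pair (pair 1 a) K)) (pair y K)"
    and evb: "\<And>x y K. eval (decode b) x = Some y \<Longrightarrow> reach (pair x (pair (pair 1 b) K)) (pair y K)"
    and "rec_nat (eval (decode a) x)
      (\<lambda>m r. Option.bind r (\<lambda>v. eval (decode b) (pair x (pair m v)))) n = Some y"
  shows "reach (pair (pair x n) (pair (pair 1 e) K)) (pair y K)"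
  using assms(7)
proof (induction n arbitrary: y K)
  case 0
  then show ?case using q by (intro reach_eval) (simp add: eval_step_def eva del: One_nat_def)
next
  case (Suc n)
  then obtain v where v: "rec_nat (eval (decode a) x)
      (\<lambda>m r. Option.bind r (\<lambda>v. eval (decode b) (pair x (pair m v)))) n = Some v"
    and y: "eval (decode b) (pair x (pair n v)) = Some y"
    by (auto simp: bind_eq_Some_conv)
  have "reach (pair v (pair (pair 4 (pair b (pair x n))) K)) (pair y K)"
    by (rule reach_frame) (simp add: frame_step_def evb[OF y, simplified])
  with Suc.IH[OF v] have "reach (pair (pair x n) (pair (pair 1 e)
      (pair (pair 4 (pair b (pair x n))) K))) (pair y K)"
    by (rule reach_trans)
  then show ?case using q by (intro reach_eval) (auto simp: eval_step_def)
qed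

text \<open>Strong induction applies because the components have smaller indices than
  \<open>e\<close>. The stack is arbitrary because components are evaluated on top of pending
  frames.\<close>

lemma reach_eval_decode:
  "eval (decode e) x = Some y \<Longrightarrow> reach (pair x (pair (pair 1 e) K)) (pair y K)"
proof (induction e arbitrary: x y K rule: less_induct)
  case (less e)
  define q where "q = (e - 4) div 4"
  define a b where "a = pfst q" and "b = psnd q"
  consider "e = 0" | "e = 1" | "e = 2" | "e = 3"
    | "e \<ge> 4" "e mod 4 = 0" | "e \<ge> 4" "e mod 4 = 1" | "e \<ge> 4" "e mod 4 = 2" | "e \<ge> 4" "e mod 4 = 3"
    by linarith
  then show ?case
  proof cases
    case 5
    then have "q < e" unfolding q_def by linarith
    then have IH: "a < e" "b < e"
      unfolding a_def b_def using fst_prod_decode_le snd_prod_decode_le le_less_trans by blast+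
    have "decode e = CPair (decode a) (decode b)"
      using 5 by (subst decode.simps) (auto simp: Let_def a_def b_def q_def)
    then obtain u v where u: "eval (decode a) x = Some u" and v: "eval (decode b) x = Some v"
      and y: "y = pair u v"
      using less.prems by (auto simp: bind_eq_Some_conv)
    have "reach (pair v (pair (pair 3 u) K)) (pair y K)"
      by (rule reach_frame) (simp add: frame_step_def y reach_refl)
    with less.IH[OF IH(2) v]
    have "reach (pair x (pair (pair 1 b) (pair (pair 3 u) K))) (pair y K)"
      by (rule reach_trans)
    then have "reach (pair u (pair (pair 2 (pair b x)) K)) (pair y K)"
      by (intro reach_frame) (simp add: frame_step_def)
    with less.IH[OF IH(1) u]
    have "reach (pair x (pair (pair 1 a) (pair (pair 2 (pair b x)) K))) (pair y K)"
      by (rule reach_trans)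
    then show ?thesis using 5 by (intro reach_eval) (auto simp: eval_step_def a_def b_def q_def)
  next
    case 6
    then have "q < e" unfolding q_def by linarith
    then have IH: "a < e" "b < e"
      unfolding a_def b_def using fst_prod_decode_le snd_prod_decode_le le_less_trans by blast+
    have "decode e = CComp (decode a) (decode b)"
      using 6 by (subst decode.simps) (auto simp: Let_def a_def b_def q_def)
    then obtain u where u: "eval (decode b) x = Some u" and y: "eval (decode a) u = Some y"
      using less.prems by (auto simp: bind_eq_Some_conv)
    from reach_trans[OF less.IH[OF IH(2) u] less.IH[OF IH(1) y]]
    show ?thesis using 6 by (intro reach_eval) (auto simp: eval_step_def a_def b_def q_def)
  next
    case 7
    then have "q < e" unfolding q_def by linarith
    then have IH: "a < e" "b < e"
      unfolding a_def b_def using fst_prod_decode_le snd_prod_decode_le le_less_trans by blast+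
    have "decode e = CPrec (decode a) (decode b)"
      using 7 by (subst decode.simps) (auto simp: Let_def a_def b_def q_def)
    with less.prems have "rec_nat (eval (decode a) (pfst x))
        (\<lambda>m r. Option.bind r (\<lambda>v. eval (decode b) (pair (pfst x) (pair m v)))) (psnd x) = Some y"
      by (simp add: Let_def)
    from reach_eval_prec[OF _ _ _ _ less.IH[OF IH(1)] less.IH[OF IH(2)] this, of e K]
    show ?thesis using 7 by (simp add: a_def b_def q_def)
  next
    case 8
    then have q: "q < e" unfolding q_def by linarith
    have "decode e = CMu (decode q)"
      using 8 by (subst decode.simps) (auto simp: Let_def q_def)
    with less.prems obtain n where n: "eval (decode q) (pair x n) = Some 0"
      "\<forall>m<n. \<exists>v. eval (decode q) (pair x m) = Some (Suc v)"
      and y: "y = (LEAST n. eval (decode q) (pair x n) = Some 0)"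
      by (auto split: if_splits)
    \<comment> \<open>All values before \<open>n\<close> are successors, so the least zero is
      \<open>n\<close>.\<close>
    have "y = n" unfolding y
      by (rule Least_equality) (use n in \<open>auto simp: not_less[symmetric]\<close>)
    with reach_eval_mu[OF less.IH[OF q] n, of 0 K]
    have "reach (pair (pair x 0) (pair (pair 1 q) (pair (pair 5 (pair q (pair x 0))) K))) (pair y K)"
      by simp
    then show ?thesis using 8 by (intro reach_eval) (auto simp: eval_step_def q_def)
  qed (use less.prems in \<open>intro reach_eval, simp add: eval_step_def decode.simps reach_refl\<close>)+
qed

text \<open>Realizers are applied only where they are defined, so an extension of \<open>app\<close> suffices.\<close>

lemma universal_code: "\<exists>u. \<forall>e x y. app e x = Some y \<longrightarrow> eval u (pair e x) = Some y"
proof -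
  define run where "run z t = (step ^^ t) (pair (psnd z) (pair (pair 1 (pfst z)) 0))" for z t
  have run_rec: "run z t = rec_nat (pair (psnd z) (pair (pair 1 (pfst z)) 0)) (\<lambda>_. step) t" for z t
    unfolding run_def by (induction t) simp_all
  have run: "computable (\<lambda>w. run (pfst w) (psnd w))"
    unfolding run_rec by (intro computable_rec comp_intros computable_compose[OF computable_step])
  then have "computable (\<lambda>w. pfst (pfst (psnd (run (pfst w) (psnd w)))))"
    by (intro comp_intros)
  \<comment> \<open>\<open>h\<close> reads the tag of the top frame, so that \<open>CMu h\<close>
    searches for the halting time; \<open>r\<close> will extract the value from the state at that
    time.\<close>
  then obtain h where h: "\<And>w. eval h w = Some (pfst (pfst (psnd (run (pfst w) (psnd w)))))"
    unfolding computable_def by blast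
  from run have "computable (\<lambda>w. pfst (run (pfst w) (psnd w)))"
    by (intro comp_intros)
  then obtain r where r: "\<And>w. eval r w = Some (pfst (run (pfst w) (psnd w)))"
    unfolding computable_def by blast
  have "eval (CComp r (CPair (CPair CFst CSnd) (CMu h))) (pair e x) = Some y"
    if app: "app e x = Some y" for e x y
  proof -
    let ?z = "pair e x"
    from app have "reach (pair x (pair (pair 1 e) 0)) (pair y 0)"
      unfolding app_def by (rule reach_eval_decode)
    then obtain t where "(step ^^ t) (pair x (pair (pair 1 e) 0)) = pair y 0"
      unfolding reach_def by blast
    then have t: "run ?z t = pair y 0" unfolding run_def prod_encode_inverse fst_conv snd_conv .
    let ?halt = "\<lambda>t. pfst (pfst (psnd (run ?z t))) = 0"
    define l where "l = Least ?halt"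
    have zero: "prod_decode 0 = (0, 0)"
      using prod_encode_inverse[of "(0, 0)"] by (simp add: prod_encode_def)
    then have ht: "?halt t" by (simp add: t)
    then have hl: "?halt l" and "l \<le> t" unfolding l_def by (auto intro: LeastI Least_le)
    \<comment> \<open>Nothing moves after the first halting time \<open>l\<close>, so the state at
      \<open>l\<close> is the final state known to occur at time \<open>t\<close>.\<close>
    have "run ?z s = run ?z l" if "l \<le> s" for s using that
    proof (induction s rule: dec_induct)
      case (step n)
      have "run ?z (Suc n) = step (run ?z n)" unfolding run_def by simp
      then show ?case using step.IH step_halted hl by simp
    qed simp
    from this[OF \<open>l \<le> t\<close>] t have rl: "run ?z l = pair y 0" by simp
    have "\<exists>v. eval h (pair ?z m) = Some (Suc v)" if "m < l" for m
      using not_less_Least[of m ?halt] that unfolding l_def by (auto simp: h gr0_conv_Suc)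
    with hl have "\<exists>n. eval h (pair ?z n) = Some 0 \<and> (\<forall>m<n. \<exists>v. eval h (pair ?z m) = Some (Suc v))"
      by (intro exI[of _ l]) (simp add: h)
    then have "eval (CMu h) ?z = Some l"
      by (simp add: h l_def)
    then show ?thesis by (simp add: r rl del: eval.simps(8))
  qed
  then show ?thesis by blast
qed

text \<open>The index produced for \<open>a\<close> codes the composition of \<open>c\<close> with
  the pairing of the constant function \<open>a\<close> and the identity.\<close>

lemma smn_code: "\<exists>s. \<forall>a. \<exists>e. eval s a = Some e \<and> (\<forall>x. app e x = eval c (pair a x))"
proof -
  obtain ci where ci: "decode ci = c" using decode_surj by blast
  obtain ii where ii: "decode ii = CPair CFst CSnd" using decode_surj by blast
  \<comment> \<open>\<open>k a\<close> is an index of the constant function \<open>a\<close>: index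
    0 is \<open>CZero\<close>, and each step composes the successor, of index 1, with the index
    \<open>r\<close> obtained so far.\<close>
  define k where "k = rec_nat 0 (\<lambda>_ r. 5 + 4 * pair 1 r)"
  have dk: "eval (decode (k a)) x = Some a" for a x
  proof (induction a)
    case 0
    show ?case by (simp add: k_def decode.simps)
  next
    case (Suc a)
    have "k (Suc a) = 5 + 4 * pair 1 (k a)" by (simp add: k_def)
    then have "decode (k (Suc a)) = CComp CSucc (decode (k a))"
      using decode_binary(2)[of 1 "k a"] decode.simps[of 1] by simp
    then show ?case by (simp add: Suc)
  qed
  have four: "4 * n = n + n + n + n" for n :: nat by simp
  have k: "computable k" unfolding k_def four
    by (intro computable_rec comp_intros)
  define s where "s a = 5 + 4 * pair ci (4 + 4 * pair (k a) ii)" for a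
  have "computable s" unfolding s_def four by (intro comp_intros k)
  then obtain sc where "\<And>a. eval sc a = Some (s a)" unfolding computable_def by blast
  moreover have "app (s a) x = eval c (pair a x)" for a x
    unfolding app_def s_def decode_binary ci ii by (simp add: dk)
  ultimately show ?thesis by blast
qed

section \<open>Uniform realizability\<close>

text \<open>The index type \<open>'i\<close> plays the role of the free variables of a sequent, and
  one code must serve all indices. A new variable is introduced by passing from \<open>i\<close> to
  pairs \<open>(i, x)\<close>.\<close>

definition entails :: "('i \<Rightarrow> nat set) \<Rightarrow> ('i \<Rightarrow> nat set) \<Rightarrow> bool" where
  "entails \<Gamma> A \<longleftrightarrow> (\<exists>c. \<forall>i. \<forall>a\<in>\<Gamma> i. \<exists>b\<in>A i. eval c a = Some b)"

lemma entailsI: "(\<And>i a. a \<in> \<Gamma> i \<Longrightarrow> \<exists>b\<in>A i. eval c a = Some b) \<Longrightarrow> entails \<Gamma> A"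
  unfolding entails_def by blast

lemma entailsE:
  assumes "entails \<Gamma> A"
  obtains c where "\<And>i a. a \<in> \<Gamma> i \<Longrightarrow> \<exists>b\<in>A i. eval c a = Some b"
  using assms unfolding entails_def by blast

lemma entails_subset:
  assumes "\<And>i. \<Gamma> i \<subseteq> A i" shows "entails \<Gamma> A"
  by (rule entailsI[of _ _ "CPair CFst CSnd"]) (use assms in auto)

lemma entails_refl: "entails \<Gamma> \<Gamma>"
  by (rule entails_subset) simp

lemma entails_trans:
  assumes "entails \<Gamma> A" "entails A B" shows "entails \<Gamma> B"
proof -
  obtain c d where c: "\<And>i a. a \<in> \<Gamma> i \<Longrightarrow> \<exists>b\<in>A i. eval c a = Some b"
    and d: "\<And>i a. a \<in> A i \<Longrightarrow> \<exists>b\<in>B i. eval d a = Some b"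
    using entailsE[OF assms(1)] entailsE[OF assms(2)] by metis
  show ?thesis
  proof (rule entailsI[of _ _ "CComp d c"])
    fix i a assume "a \<in> \<Gamma> i"
    from c[OF this] obtain b where b: "b \<in> A i" "eval c a = Some b" by blast
    from d[OF b(1)] b(2) show "\<exists>b\<in>B i. eval (CComp d c) a = Some b" by simp
  qed
qed

lemma entails_subst:
  assumes "entails \<Gamma> A" shows "entails (\<lambda>i. \<Gamma> (f i)) (\<lambda>i. A (f i))"
proof -
  obtain c where "\<And>i a. a \<in> \<Gamma> i \<Longrightarrow> \<exists>b\<in>A i. eval c a = Some b"
    using entailsE[OF assms] by metis
  then show ?thesis by (rule entailsI)
qed

lemma entails_const:
  assumes "a \<in> A" shows "entails \<Gamma> (\<lambda>_. A)"
proof -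
  obtain c where "\<And>x. eval c x = Some a" using computable_const unfolding computable_def by blast
  with assms show ?thesis by (intro entailsI[of _ _ c]) auto
qed

lemma entails_conjI:
  assumes "entails \<Gamma> A" "entails \<Gamma> B" shows "entails \<Gamma> (\<lambda>i. A i \<^bold>\<and> B i)"
proof -
  obtain c d where c: "\<And>i a. a \<in> \<Gamma> i \<Longrightarrow> \<exists>b\<in>A i. eval c a = Some b"
    and d: "\<And>i a. a \<in> \<Gamma> i \<Longrightarrow> \<exists>b\<in>B i. eval d a = Some b"
    using entailsE[OF assms(1)] entailsE[OF assms(2)] by metis
  show ?thesis
  proof (rule entailsI[of _ _ "CPair c d"])
    fix i a assume "a \<in> \<Gamma> i"
    from c[OF this] d[OF this] show "\<exists>b\<in>A i \<^bold>\<and> B i. eval (CPair c d) a = Some b"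
      unfolding rconj_def by auto
  qed
qed

lemma entails_conj_fst: "entails (\<lambda>i. A i \<^bold>\<and> B i) A"
  by (rule entailsI[of _ _ CFst]) (auto simp: rconj_def)

lemma entails_conj_snd: "entails (\<lambda>i. A i \<^bold>\<and> B i) B"
  by (rule entailsI[of _ _ CSnd]) (auto simp: rconj_def)

lemma entails_conjD1: "entails \<Gamma> (\<lambda>i. A i \<^bold>\<and> B i) \<Longrightarrow> entails \<Gamma> A"
  and entails_conjD2: "entails \<Gamma> (\<lambda>i. A i \<^bold>\<and> B i) \<Longrightarrow> entails \<Gamma> B"
  by (erule entails_trans, rule entails_conj_fst) (erule entails_trans, rule entails_conj_snd)

lemma entails_weaken: "entails \<Gamma> A \<Longrightarrow> entails (\<lambda>i. \<Gamma> i \<^bold>\<and> B i) A"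
  by (rule entails_trans[OF entails_conj_fst])

lemma entails_cut: "entails \<Gamma> A \<Longrightarrow> entails (\<lambda>i. \<Gamma> i \<^bold>\<and> A i) B \<Longrightarrow> entails \<Gamma> B"
  by (rule entails_trans[OF entails_conjI[OF entails_refl]])

lemma entails_impI:
  assumes "entails (\<lambda>i. \<Gamma> i \<^bold>\<and> A i) B" shows "entails \<Gamma> (\<lambda>i. A i \<^bold>\<longrightarrow> B i)"
proof -
  obtain c where c: "\<And>i a. a \<in> (\<Gamma> i \<^bold>\<and> A i) \<Longrightarrow> \<exists>b\<in>B i. eval c a = Some b"
    using entailsE[OF assms] by metis
  obtain s where s: "\<And>a. \<exists>e. eval s a = Some e \<and> (\<forall>x. app e x = eval c (pair a x))"
    using smn_code by blast
  show ?thesis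
  proof (rule entailsI[of _ _ s])
    fix i a assume a: "a \<in> \<Gamma> i"
    obtain e where e: "eval s a = Some e" "\<And>x. app e x = eval c (pair a x)" using s by blast
    have "e \<in> (A i \<^bold>\<longrightarrow> B i)"
      unfolding rimp_def using c a by (auto simp: e rconj_def)
    with e show "\<exists>b\<in>A i \<^bold>\<longrightarrow> B i. eval s a = Some b" by blast
  qed
qed

lemma entails_mp:
  assumes "entails \<Gamma> (\<lambda>i. A i \<^bold>\<longrightarrow> B i)" "entails \<Gamma> A" shows "entails \<Gamma> B"
proof -
  obtain u where u: "\<And>e x y. app e x = Some y \<Longrightarrow> eval u (pair e x) = Some y"
    using universal_code by blast
  have "entails (\<lambda>i. (A i \<^bold>\<longrightarrow> B i) \<^bold>\<and> A i) B"
  proof (rule entailsI[of _ _ u])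
    fix i z assume "z \<in> ((A i \<^bold>\<longrightarrow> B i) \<^bold>\<and> A i)"
    then obtain e a b where "z = pair e a" "b \<in> B i" "app e a = Some b"
      unfolding rconj_def rimp_def by blast
    then show "\<exists>b\<in>B i. eval u z = Some b" using u by blast
  qed
  with entails_conjI[OF assms] show ?thesis by (rule entails_trans)
qed

lemma entails_disjI1: "entails \<Gamma> A \<Longrightarrow> entails \<Gamma> (\<lambda>i. A i \<^bold>\<or> B i)"
  by (rule entails_trans, assumption, rule entailsI[of _ _ "CPair CZero (CPair CFst CSnd)"])
    (auto simp: rdisj_def)

lemma entails_disjI2: "entails \<Gamma> B \<Longrightarrow> entails \<Gamma> (\<lambda>i. A i \<^bold>\<or> B i)"
  by (rule entails_trans, assumption, rule entailsI[of _ _ "CPair (CComp CSucc CZero) (CPair CFst CSnd)"])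
    (auto simp: rdisj_def)

lemma entails_disjE:
  assumes "entails \<Gamma> (\<lambda>i. A i \<^bold>\<or> B i)"
    and "entails (\<lambda>i. \<Gamma> i \<^bold>\<and> A i) C" "entails (\<lambda>i. \<Gamma> i \<^bold>\<and> B i) C"
  shows "entails \<Gamma> C"
proof -
  obtain c d where c: "\<And>i a. a \<in> (\<Gamma> i \<^bold>\<and> A i) \<Longrightarrow> \<exists>b\<in>C i. eval c a = Some b"
    and d: "\<And>i a. a \<in> (\<Gamma> i \<^bold>\<and> B i) \<Longrightarrow> \<exists>b\<in>C i. eval d a = Some b"
    using entailsE[OF assms(2)] entailsE[OF assms(3)] by metis
  \<comment> \<open>\<open>c\<close> and \<open>d\<close> may diverge outside their own case, so the
    total case distinction is made between indices: the tag selects \<open>m\<close> or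
    \<open>n\<close>, and the universal code runs the selected one.\<close>
  obtain m n where m: "decode m = c" and n: "decode n = d" using decode_surj by metis
  obtain u where u: "\<And>e x y. app e x = Some y \<Longrightarrow> eval u (pair e x) = Some y"
    using universal_code by blast
  have "computable (\<lambda>z. pair (if pfst (psnd z) = 0 then m else n) (pair (pfst z) (psnd (psnd z))))"
    by (intro comp_intros)
  then obtain s where s: "\<And>z. eval s z =
      Some (pair (if pfst (psnd z) = 0 then m else n) (pair (pfst z) (psnd (psnd z))))"
    unfolding computable_def by blast
  have "entails (\<lambda>i. \<Gamma> i \<^bold>\<and> (A i \<^bold>\<or> B i)) C"
  proof (rule entailsI[of _ _ "CComp u s"])
    fix i z assume "z \<in> (\<Gamma> i \<^bold>\<and> (A i \<^bold>\<or> B i))"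
    then consider g a where "z = pair g (pair 0 a)" "g \<in> \<Gamma> i" "a \<in> A i"
      | g b where "z = pair g (pair 1 b)" "g \<in> \<Gamma> i" "b \<in> B i"
      unfolding rconj_def rdisj_def by blast
    then show "\<exists>b\<in>C i. eval (CComp u s) z = Some b"
    proof cases
      case 1
      then obtain b where "b \<in> C i" "eval c (pair g a) = Some b"
        using c[of "pair g a" i] unfolding rconj_def by blast
      then show ?thesis using 1 u[of m "pair g a"] by (simp add: s app_def m)
    next
      case 2
      then obtain x where "x \<in> C i" "eval d (pair g b) = Some x"
        using d[of "pair g b" i] unfolding rconj_def by blast
      then show ?thesis using 2 u[of n "pair g b"] by (simp add: s app_def n)
    qed
  qed
  with assms(1) show ?thesis by (rule entails_cut)
qed

lemma entails_INT_I:
  assumes "entails (\<lambda>p. \<Gamma> (fst p)) (\<lambda>p. A (fst p) (snd p))"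
  shows "entails \<Gamma> (\<lambda>i. \<Inter>x. A i x)"
proof -
  obtain c where c: "\<And>p a. a \<in> \<Gamma> (fst p) \<Longrightarrow> \<exists>b\<in>A (fst p) (snd p). eval c a = Some b"
    using entailsE[OF assms] by metis
  show ?thesis
  proof (rule entailsI[of _ _ c])
    fix i a assume a: "a \<in> \<Gamma> i"
    then have x: "\<exists>b\<in>A i x. eval c a = Some b" for x using c[of a "(i, x)"] by simp
    \<comment> \<open>Any one \<open>x\<close> shows that the value exists; as the code does not see
      \<open>x\<close>, the same value lies in all \<open>A i x\<close>.\<close>
    from x[of undefined] obtain b where b: "eval c a = Some b" by blast
    with x have "b \<in> A i x" for x by fastforce
    with b show "\<exists>b\<in>\<Inter>x. A i x. eval c a = Some b" by blast
  qed
qed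

text \<open>The instance \<open>f\<close> may be an arbitrary function, computable or not, because
  an intersection leaves no trace of \<open>x\<close> in the realizer.\<close>

lemma entails_INT_D: "entails \<Gamma> (\<lambda>i. \<Inter>x. A i x) \<Longrightarrow> entails \<Gamma> (\<lambda>i. A i (f i))"
  by (rule entails_trans, assumption, rule entails_subset) blast

lemma entails_UN_I: "entails \<Gamma> (\<lambda>i. A i (f i)) \<Longrightarrow> entails \<Gamma> (\<lambda>i. \<Union>x. A i x)"
  by (rule entails_trans, assumption, rule entails_subset) blast

lemma entails_UN_E:
  assumes "entails \<Gamma> (\<lambda>i. \<Union>x. A i x)"
    and "entails (\<lambda>p. \<Gamma> (fst p) \<^bold>\<and> A (fst p) (snd p)) (\<lambda>p. B (fst p))"
  shows "entails \<Gamma> B"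
proof -
  have "entails (\<lambda>i. \<Gamma> i \<^bold>\<and> (\<Union>x. A i x)) B"
  proof -
    obtain c where c: "\<And>p a. a \<in> (\<Gamma> (fst p) \<^bold>\<and> A (fst p) (snd p)) \<Longrightarrow> \<exists>b\<in>B (fst p). eval c a = Some b"
      using entailsE[OF assms(2)] by metis
    show ?thesis
    proof (rule entailsI[of _ _ c])
      fix i z assume "z \<in> (\<Gamma> i \<^bold>\<and> (\<Union>x. A i x))"
      then obtain x where "z \<in> (\<Gamma> i \<^bold>\<and> A i x)" unfolding rconj_def by blast
      then show "\<exists>b\<in>B i. eval c z = Some b" using c[of z "(i, x)"] by simp
    qed
  qed
  with assms(1) show ?thesis by (rule entails_cut)
qed

lemma entails_iffI:
  assumes "entails (\<lambda>i. \<Gamma> i \<^bold>\<and> A i) B" "entails (\<lambda>i. \<Gamma> i \<^bold>\<and> B i) A"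
  shows "entails \<Gamma> (\<lambda>i. A i \<^bold>\<longleftrightarrow> B i)"
  unfolding riff_def by (intro entails_conjI entails_impI assms)

lemma entails_iffD2: "entails \<Gamma> (\<lambda>i. A i \<^bold>\<longleftrightarrow> B i) \<Longrightarrow> entails \<Gamma> A \<Longrightarrow> entails \<Gamma> B"
  unfolding riff_def by (rule entails_mp[OF entails_conjD1])

section \<open>Local operators as monads\<close>

lemma islop_unit:
  assumes "entails \<Gamma> (\<lambda>i. islop (k i))" "entails \<Gamma> A"
  shows "entails \<Gamma> (\<lambda>i. k i (A i))"
proof -
  have "entails \<Gamma> (\<lambda>i. \<Inter>p. p \<^bold>\<longrightarrow> k i p)"
    using assms(1) unfolding islop_def by (rule entails_conjD1)
  from entails_mp[OF entails_INT_D[OF this, of A] assms(2)] show ?thesis .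
qed

text \<open>Kleisli extension in context: monotonicity along the implication from \<open>A\<close>
  to \<open>k B\<close> gives \<open>k (k B)\<close>, and idempotence collapses it.\<close>

lemma islop_bind:
  assumes lop: "entails \<Gamma> (\<lambda>i. islop (k i))" and A: "entails \<Gamma> (\<lambda>i. k i (A i))"
    and B: "entails (\<lambda>i. \<Gamma> i \<^bold>\<and> A i) (\<lambda>i. k i (B i))"
  shows "entails \<Gamma> (\<lambda>i. k i (B i))"
proof -
  have *: "entails \<Gamma> (\<lambda>i. (\<Inter>p. k i (k i p) \<^bold>\<longrightarrow> k i p) \<^bold>\<and>
      (\<Inter>p q. (p \<^bold>\<longrightarrow> q) \<^bold>\<longrightarrow> (k i p \<^bold>\<longrightarrow> k i q)))"
    using lop unfolding islop_def by (rule entails_conjD2)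
  have "entails \<Gamma> (\<lambda>i. (A i \<^bold>\<longrightarrow> k i (B i)) \<^bold>\<longrightarrow> (k i (A i) \<^bold>\<longrightarrow> k i (k i (B i))))"
    using entails_INT_D[OF entails_INT_D[OF entails_conjD2[OF *], of A], of "\<lambda>i. k i (B i)"] .
  from entails_mp[OF entails_mp[OF this entails_impI[OF B]] A]
  have "entails \<Gamma> (\<lambda>i. k i (k i (B i)))" .
  with entails_INT_D[OF entails_conjD1[OF *], of B] show ?thesis
    by (rule entails_mp)
qed

lemma islop_map:
  assumes "entails \<Gamma> (\<lambda>i. islop (k i))" "entails \<Gamma> (\<lambda>i. k i (A i))"
    and "entails (\<lambda>i. \<Gamma> i \<^bold>\<and> A i) B"
  shows "entails \<Gamma> (\<lambda>i. k i (B i))"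
  using assms(1,2) islop_unit[OF entails_weaken[OF assms(1)] assms(3)] by (rule islop_bind)

text \<open>The quantifiers of \<open>frc\<close> are guarded by \<open>eqPOmega k k\<close>, of
  which \<open>rlz\<close> knows nothing; for local operators the guard is realized. Strictness and
  reflexivity come down to identities, and extensionality transports \<open>p\<close> to an
  equivalent \<open>q\<close> under \<open>k\<close>.\<close>

lemma islop_exists:
  assumes lop: "entails \<Gamma> (\<lambda>i. islop (k i))"
  shows "entails \<Gamma> (\<lambda>i. eqPOmega (k i) (k i))"
  unfolding eqPow_def eqOmega_def req_def
proof (intro entails_conjI entails_INT_I entails_impI entails_iffI entails_conj_snd)
  let ?\<Delta> = "\<lambda>p. \<Gamma> (fst (fst p)) \<^bold>\<and> k (fst (fst p)) (snd (fst p)) \<^bold>\<and> (snd (fst p) \<^bold>\<longleftrightarrow> snd p)"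
  have h: "entails ?\<Delta> (\<lambda>p. k (fst (fst p)) (snd (fst p)) \<^bold>\<and> (snd (fst p) \<^bold>\<longleftrightarrow> snd p))"
    by (rule entails_conj_snd)
  have l: "entails ?\<Delta> (\<lambda>p. islop (k (fst (fst p))))"
    by (rule entails_weaken, rule entails_subst[OF lop])
  have "entails (\<lambda>p. ?\<Delta> p \<^bold>\<and> snd (fst p)) (\<lambda>p. k (fst (fst p)) (snd p))"
    by (rule islop_unit[OF entails_weaken[OF l]],
        rule entails_iffD2[OF entails_weaken[OF entails_conjD2[OF h]] entails_conj_snd])
  with l entails_conjD1[OF h] show "entails ?\<Delta> (\<lambda>p. k (fst (fst p)) (snd p))"
    by (rule islop_bind)
qed

section \<open>Computability of terms\<close>

primrec encode_env :: "nat list \<Rightarrow> nat" where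
  "encode_env [] = 0"
| "encode_env (x # xs) = pair x (encode_env xs)"

text \<open>The length is fixed because \<open>encode_env\<close> does not record it and because
  \<open>hd\<close> and list lookup are meaningful only on long enough lists.\<close>

definition env_computable :: "nat \<Rightarrow> (nat list \<Rightarrow> nat) \<Rightarrow> bool" where
  "env_computable n f \<longleftrightarrow> (\<exists>c. \<forall>xs. length xs = n \<longrightarrow> eval c (encode_env xs) = Some (f xs))"

lemma env_computable_nth: "i < n \<Longrightarrow> env_computable n (\<lambda>xs. xs ! i)"
proof (induction i arbitrary: n)
  case 0
  have "eval CFst (encode_env xs) = Some (xs ! 0)" if "length xs = n" for xs
    using that 0 by (cases xs) auto
  then show ?case unfolding env_computable_def by blast
next
  case (Suc i)
  then obtain m where m: "n = Suc m" "i < m" by (cases n) auto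
  then obtain c where c: "\<And>xs. length xs = m \<Longrightarrow> eval c (encode_env xs) = Some (xs ! i)"
    using Suc.IH unfolding env_computable_def by blast
  have "eval (CComp c CSnd) (encode_env xs) = Some (xs ! Suc i)" if "length xs = n" for xs
    using that m c by (cases xs) auto
  then show ?case unfolding env_computable_def by blast
qed

lemma env_computable_compose:
  assumes "computable f" "env_computable n g" shows "env_computable n (\<lambda>xs. f (g xs))"
proof -
  obtain c d where c: "\<And>x. eval c x = Some (f x)"
    and d: "\<And>xs. length xs = n \<Longrightarrow> eval d (encode_env xs) = Some (g xs)"
    using assms unfolding computable_def env_computable_def by metis
  then have "\<forall>xs. length xs = n \<longrightarrow> eval (CComp c d) (encode_env xs) = Some (f (g xs))" by simp
  then show ?thesis unfolding env_computable_def by blast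
qed

text \<open>\<open>h\<close> covers two uses: argument terms under \<open>tm_val\<close> and
  component functions under \<open>prf_eval\<close>.\<close>

lemma env_computable_map:
  assumes "\<And>t. t \<in> set ts \<Longrightarrow> env_computable n (\<lambda>xs. h xs t)"
  shows "env_computable n (\<lambda>xs. encode_env (map (h xs) ts))"
  using assms
proof (induction ts)
  case Nil
  have "\<forall>xs. length xs = n \<longrightarrow> eval CZero (encode_env xs) = Some (encode_env (map (h xs) []))" by simp
  then show ?case unfolding env_computable_def by blast
next
  case (Cons t ts)
  then have "env_computable n (\<lambda>xs. h xs t)" "env_computable n (\<lambda>xs. encode_env (map (h xs) ts))"
    by simp_all
  then obtain c d where "\<And>xs. length xs = n \<Longrightarrow> eval c (encode_env xs) = Some (h xs t)"
    "\<And>xs. length xs = n \<Longrightarrow> eval d (encode_env xs) = Some (encode_env (map (h xs) ts))"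
    unfolding env_computable_def by metis
  then have "\<forall>xs. length xs = n \<longrightarrow>
      eval (CPair c d) (encode_env xs) = Some (encode_env (map (h xs) (t # ts)))" by simp
  then show ?case unfolding env_computable_def by blast
qed

lemma env_computable_compose_map:
  assumes "env_computable (length ts) f" "\<And>t. t \<in> set ts \<Longrightarrow> env_computable n (\<lambda>xs. h xs t)"
  shows "env_computable n (\<lambda>xs. f (map (h xs) ts))"
proof -
  obtain c where c: "\<And>xs. length xs = length ts \<Longrightarrow> eval c (encode_env xs) = Some (f xs)"
    using assms(1) unfolding env_computable_def by blast
  obtain d where d: "\<And>xs. length xs = n \<Longrightarrow> eval d (encode_env xs) = Some (encode_env (map (h xs) ts))"
    using env_computable_map[of ts n h] assms(2) unfolding env_computable_def by blast
  have "\<forall>xs. length xs = n \<longrightarrow> eval (CComp c d) (encode_env xs) = Some (f (map (h xs) ts))"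
    by (simp add: c d)
  then show ?thesis unfolding env_computable_def by blast
qed

lemma env_computable_rec:
  assumes "env_computable n f" "env_computable (Suc (Suc n)) g"
  shows "env_computable (Suc n)
    (\<lambda>xs. rec_nat (f (tl xs)) (\<lambda>m r. g (m # r # tl xs)) (hd xs))"
proof -
  obtain c d where c: "\<And>xs. length xs = n \<Longrightarrow> eval c (encode_env xs) = Some (f xs)"
    and d: "\<And>xs. length xs = Suc (Suc n) \<Longrightarrow> eval d (encode_env xs) = Some (g xs)"
    using assms unfolding env_computable_def by metis
  \<comment> \<open>\<open>CPrec\<close> hands over the encoding of \<open>xs\<close> paired with
    \<open>pair m v\<close>, whereas \<open>g\<close> expects a list starting with \<open>m\<close>
    and \<open>v\<close>; \<open>d'\<close> reorders the entries.\<close>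
  define d' where "d' = CComp d (CPair (CComp CFst CSnd) (CPair (CComp CSnd CSnd) CFst))"
  have d': "eval d' (pair (encode_env xs) (pair m v)) = Some (g (m # v # xs))" if "length xs = n" for xs m v
    using d[of "m # v # xs"] that by (simp add: d'_def)
  have rec: "rec_nat (eval c (encode_env xs))
      (\<lambda>m r. Option.bind r (\<lambda>v. eval d' (pair (encode_env xs) (pair m v)))) k
    = Some (rec_nat (f xs) (\<lambda>m r. g (m # r # xs)) k)" if "length xs = n" for xs k
    by (induction k) (simp_all add: c d' that)
  \<comment> \<open>The recursion argument heads the list but comes second for \<open>CPrec\<close>,
    so head and tail are swapped first.\<close>
  have "eval (CComp (CPrec c d') (CPair CSnd CFst)) (encode_env xs) =
      Some (rec_nat (f (tl xs)) (\<lambda>m r. g (m # r # tl xs)) (hd xs))" if "length xs = Suc n" for xs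
    using that by (cases xs) (simp_all add: rec Let_def)
  then show ?thesis unfolding env_computable_def by blast
qed

lemma env_computable_prf_eval: "prf_arity f n \<Longrightarrow> env_computable n (prf_eval f)"
proof (induction f arbitrary: n)
  case PZero
  have "\<forall>xs. length xs = n \<longrightarrow> eval CZero (encode_env xs) = Some (prf_eval PZero xs)" by simp
  then show ?case unfolding env_computable_def by blast
next
  case PSucc
  then have n: "n = 1" by simp
  have "eval (CComp CSucc CFst) (encode_env xs) = Some (prf_eval PSucc xs)" if "length xs = n" for xs
    using that n by (cases xs) auto
  then show ?case unfolding env_computable_def by blast
next
  case (PProj i)
  then show ?case using env_computable_nth[of i n] by simp
next
  case (PComp f gs)
  then show ?case
    using env_computable_compose_map[of gs "prf_eval f" n "\<lambda>xs g. prf_eval g xs"] by simp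
next
  case (PRec f g)
  then obtain m where m: "n = Suc m" by (cases n) auto
  with PRec have "env_computable m (prf_eval f)" "env_computable (Suc (Suc m)) (prf_eval g)"
    by simp_all
  from env_computable_rec[OF this] show ?case by (simp add: m)
qed

lemma env_computable_tm_val: "wf_tm m t \<Longrightarrow> env_computable m (\<lambda>ns. tm_val ns t)"
proof (induction t)
  case (Var i)
  then show ?case using env_computable_nth by simp
next
  case Zero
  have "\<forall>xs. length xs = m \<longrightarrow> eval CZero (encode_env xs) = Some (tm_val xs Zero)" by simp
  then show ?case unfolding env_computable_def by blast
next
  case (Succ t)
  then show ?case
    using env_computable_compose[OF computable_Suc[OF computable_id]] by simp
next
  case (Fn f ts)
  then show ?case
    using env_computable_compose_map[of ts "prf_eval f" m tm_val] env_computable_prf_eval by simp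
qed

text \<open>
  The existence predicate of environments of length \<open>m\<close>; being empty for other lengths, it lets
  entailments range over all lists.
\<close>

definition env :: "nat \<Rightarrow> nat list \<Rightarrow> nat set" where
  "env m ns = (if length ns = m then {encode_env ns} else {})"

lemma entails_tm_val:
  assumes "wf_tm m t" "entails \<Gamma> (\<lambda>i. env m (ns i))"
  shows "entails \<Gamma> (\<lambda>i. {tm_val (ns i) t})"
proof -
  obtain c where "\<And>ns. length ns = m \<Longrightarrow> eval c (encode_env ns) = Some (tm_val ns t)"
    using env_computable_tm_val[OF assms(1)] unfolding env_computable_def by blast
  then have "entails (\<lambda>i. env m (ns i)) (\<lambda>i. {tm_val (ns i) t})"
    by (intro entailsI[of _ _ c]) (auto simp: env_def split: if_splits)
  with assms(2) show ?thesis by (rule entails_trans)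
qed

lemma entails_env_Cons:
  assumes "entails \<Gamma> (\<lambda>i. {x i})" "entails \<Gamma> (\<lambda>i. env m (ns i))"
  shows "entails \<Gamma> (\<lambda>i. env (Suc m) (x i # ns i))"
  by (rule entails_trans[OF entails_conjI[OF assms]], rule entails_subset)
    (auto simp: env_def rconj_def)

section \<open>Members of a lop-frame and the order on local operators\<close>

lemma entails_islop:
  assumes "lop_frame P" "entails \<Gamma> (\<lambda>i. P (k i))"
  shows "entails \<Gamma> (\<lambda>i. islop (k i))"
proof -
  have "(\<Inter>j. P j \<^bold>\<longrightarrow> islop j) \<noteq> {}"
    using assms(1) unfolding lop_frame_def by (rule conjunct2)
  then obtain e where e: "\<And>j. e \<in> (P j \<^bold>\<longrightarrow> islop j)"
    unfolding ex_in_conv[symmetric] by blast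
  have "entails (\<lambda>i. P (k i)) (\<lambda>i. islop (k i))"
    using e by (intro entailsI[of _ _ "decode e"]) (auto simp: rimp_def app_def)
  with assms(2) show ?thesis by (rule entails_trans)
qed

text \<open>The denotation of the internal order \<open>j \<le> k\<close>.\<close>

definition ole :: "lop \<Rightarrow> lop \<Rightarrow> nat set" where
  "ole j k = forall_in eqOmega (\<lambda>p. j p \<^bold>\<longrightarrow> k p)"

text \<open>The internal order adds the premise that the truth value exists. It is weakened away
  here, and \<open>entails_rsub\<close> discharges it by the trivial equivalence of a truth value
  with itself.\<close>

lemma entails_ole:
  assumes "entails \<Gamma> (\<lambda>i. j i \<^bold>\<sqsubseteq> k i)" shows "entails \<Gamma> (\<lambda>i. ole (j i) (k i))"
  unfolding ole_def forall_in_def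
proof (rule entails_INT_I, rule entails_impI, rule entails_weaken)
  have "entails (\<lambda>p. \<Gamma> (fst p)) (\<lambda>p. \<Inter>q. j (fst p) q \<^bold>\<longrightarrow> k (fst p) q)"
    using entails_subst[OF assms, of fst] unfolding rsub_def .
  then show "entails (\<lambda>p. \<Gamma> (fst p)) (\<lambda>p. j (fst p) (snd p) \<^bold>\<longrightarrow> k (fst p) (snd p))"
    by (rule entails_INT_D)
qed

lemma entails_rsub:
  assumes "entails \<Gamma> (\<lambda>i. ole (j i) (k i))" shows "entails \<Gamma> (\<lambda>i. j i \<^bold>\<sqsubseteq> k i)"
  unfolding rsub_def
proof (rule entails_INT_I)
  have "entails (\<lambda>p. \<Gamma> (fst p)) (\<lambda>p. \<Inter>q. eqOmega q q \<^bold>\<longrightarrow> (j (fst p) q \<^bold>\<longrightarrow> k (fst p) q))"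
    using entails_subst[OF assms, of fst] unfolding ole_def forall_in_def .
  from entails_INT_D[OF this, of snd]
  show "entails (\<lambda>p. \<Gamma> (fst p)) (\<lambda>p. j (fst p) (snd p) \<^bold>\<longrightarrow> k (fst p) (snd p))"
    by (rule entails_mp) (unfold eqOmega_def, intro entails_iffI entails_conj_snd)
qed

lemma entails_rsub_apply:
  assumes "entails \<Gamma> (\<lambda>i. j i \<^bold>\<sqsubseteq> k i)" "entails \<Gamma> (\<lambda>i. j i (A i))"
  shows "entails \<Gamma> (\<lambda>i. k i (A i))"
  using entails_mp[OF entails_INT_D[OF assms(1)[unfolded rsub_def], of A] assms(2)] .

section \<open>Comparison of forcing and realizability\<close>

text \<open>The denotation of \<open>forces P j \<phi>\<close>, see \<open>interp_forces\<close>.\<close>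

primrec frc :: "frame \<Rightarrow> fm \<Rightarrow> lop \<Rightarrow> nat list \<Rightarrow> nat set" where
  "frc P Bot j ns = j {}"
| "frc P (Eq t s) j ns = j (eqN (tm_val ns t) (tm_val ns s))"
| "frc P (And \<phi> \<psi>) j ns = (frc P \<phi> j ns \<^bold>\<and> frc P \<psi> j ns)"
| "frc P (Or \<phi> \<psi>) j ns = j (frc P \<phi> j ns \<^bold>\<or> frc P \<psi> j ns)"
| "frc P (Imp \<phi> \<psi>) j ns =
     (\<Inter>k. eqPOmega k k \<^bold>\<longrightarrow> P k \<^bold>\<longrightarrow> ole j k \<^bold>\<longrightarrow> frc P \<phi> k ns \<^bold>\<longrightarrow> frc P \<psi> k ns)"
| "frc P (All \<phi>) j ns =
     (\<Inter>k. eqPOmega k k \<^bold>\<longrightarrow> P k \<^bold>\<longrightarrow> ole j k \<^bold>\<longrightarrow> (\<Inter>n. {n} \<^bold>\<longrightarrow> frc P \<phi> k (n # ns)))"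
| "frc P (Ex \<phi>) j ns = j (\<Union>n. {n} \<^bold>\<and> frc P \<phi> j (n # ns))"

lemma po_val_lift: "po_val (k # ks) (lift_po J) = po_val ks J"
  by (cases J) simp_all

text \<open>\<open>J\<close> and \<open>ks\<close> vary in the induction: below
  \<open>IAllGe\<close> the local operator becomes \<open>POVar 0\<close>, and
  \<open>po_val_lift\<close> preserves the value of the outer one.\<close>

lemma interp_forces: "interp (forces P J \<phi>) ns ps ks = frc P \<phi> (po_val ks J) ns"
  by (induction \<phi> arbitrary: J ns ps ks)
    (simp_all add: IAllGe_def ILe_def ole_def forall_in_def exists_in_def po_val_lift eqN_def)

lemma tm_val_numeral: "tm_val ns (numeral_tm n) = n"
  by (induction n) simp_all

text \<open>\<open>ms\<close> lists the values of the \<open>d\<close> variables bound so far, and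
  \<open>ns\<close> the numbers whose numerals replace the others.\<close>

lemma tm_val_inst:
  "length ms = d \<Longrightarrow> tm_val ms (inst_tm d ns t) = tm_val (ms @ ns) t"
  by (induction t) (auto simp: tm_val_numeral nth_append comp_def intro: arg_cong[where f = "prf_eval _"])

lemma frc_inst: "length ms = d \<Longrightarrow> frc P (inst_fm d ns \<phi>) j ms = frc P \<phi> j (ms @ ns)"
proof (induction \<phi> arbitrary: d ms j)
  case (All \<phi>)
  then have "frc P (inst_fm (Suc d) ns \<phi>) k (n # ms) = frc P \<phi> k (n # ms @ ns)" for n k
    using All.IH[of "n # ms" "Suc d" k] by simp
  then show ?case by simp
next
  case (Ex \<phi>)
  then have "frc P (inst_fm (Suc d) ns \<phi>) k (n # ms) = frc P \<phi> k (n # ms @ ns)" for n k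
    using Ex.IH[of "n # ms" "Suc d" k] by simp
  then show ?case by simp
qed (simp_all add: tm_val_inst)

text \<open>Membership in \<open>P\<close> gives \<open>islop\<close> and thereby the existence
  guard; the order guard comes from \<open>entails_ole\<close>.\<close>

lemma frc_above_mp:
  assumes P: "lop_frame P" and pk: "entails \<Gamma> (\<lambda>i. P (k i))" and jk: "entails \<Gamma> (\<lambda>i. j i \<^bold>\<sqsubseteq> k i)"
    and "entails \<Gamma> (\<lambda>i. \<Inter>k. eqPOmega k k \<^bold>\<longrightarrow> P k \<^bold>\<longrightarrow> ole (j i) k \<^bold>\<longrightarrow> B i k)"
  shows "entails \<Gamma> (\<lambda>i. B i (k i))"
  by (rule entails_mp[OF entails_mp[OF entails_mp[OF entails_INT_D[OF assms(4), of k]]]])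
    (intro islop_exists entails_islop[OF P] pk entails_ole jk)+

lemma frc_above_I:
  assumes "entails (\<lambda>p. \<Gamma> (fst p) \<^bold>\<and> P (snd p) \<^bold>\<and> (j (fst p) \<^bold>\<sqsubseteq> snd p)) (\<lambda>p. B (fst p) (snd p))"
  shows "entails \<Gamma> (\<lambda>i. \<Inter>k. eqPOmega k k \<^bold>\<longrightarrow> P k \<^bold>\<longrightarrow> ole (j i) k \<^bold>\<longrightarrow> B i k)"
proof (intro entails_INT_I entails_impI, rule entails_trans[OF _ assms], intro entails_conjI)
  let ?\<Delta> = "\<lambda>p. ((\<Gamma> (fst p) \<^bold>\<and> eqPOmega (snd p) (snd p)) \<^bold>\<and> P (snd p)) \<^bold>\<and> ole (j (fst p)) (snd p)"
  show "entails ?\<Delta> (\<lambda>p. \<Gamma> (fst p))"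
    by (intro entails_weaken entails_refl)
  show "entails ?\<Delta> (\<lambda>p. P (snd p))"
    by (rule entails_weaken, rule entails_conj_snd)
  show "entails ?\<Delta> (\<lambda>p. j (fst p) \<^bold>\<sqsubseteq> snd p)"
    by (rule entails_rsub, rule entails_conj_snd)
qed

text \<open>The context asks for \<open>islop\<close> rather than membership in \<open>P\<close>,
  since the outermost \<open>j\<close> need not lie in the frame. The environment supplies the
  values of the free variables to the realizers.\<close>

definition agree :: "frame \<Rightarrow> nat \<Rightarrow> fm \<Rightarrow> bool" where
  "agree P m \<phi> \<longleftrightarrow> entails (\<lambda>x. islop (fst x) \<^bold>\<and> env m (snd x))
     (\<lambda>x. frc P \<phi> (fst x) (snd x) \<^bold>\<longleftrightarrow> fst x (rlz P \<phi> (fst x) (snd x)))"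

lemma agreeI:
  assumes "entails (\<lambda>x. (islop (fst x) \<^bold>\<and> env m (snd x)) \<^bold>\<and> frc P \<phi> (fst x) (snd x))
      (\<lambda>x. fst x (rlz P \<phi> (fst x) (snd x)))"
    and "entails (\<lambda>x. (islop (fst x) \<^bold>\<and> env m (snd x)) \<^bold>\<and> fst x (rlz P \<phi> (fst x) (snd x)))
      (\<lambda>x. frc P \<phi> (fst x) (snd x))"
  shows "agree P m \<phi>"
  unfolding agree_def using assms by (rule entails_iffI)

lemma agree_iff:
  assumes "agree P m \<phi>" "entails \<Gamma> (\<lambda>i. islop (j i))" "entails \<Gamma> (\<lambda>i. env m (ns i))"
  shows "entails \<Gamma> (\<lambda>i. frc P \<phi> (j i) (ns i) \<^bold>\<longleftrightarrow> j i (rlz P \<phi> (j i) (ns i)))"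
  using entails_trans[OF entails_conjI[OF assms(2,3)]
      entails_subst[OF assms(1)[unfolded agree_def], of "\<lambda>i. (j i, ns i)", unfolded fst_conv snd_conv]] .

lemma agree_rlz:
  assumes "agree P m \<phi>" "entails \<Gamma> (\<lambda>i. islop (j i))" "entails \<Gamma> (\<lambda>i. env m (ns i))"
    and "entails \<Gamma> (\<lambda>i. frc P \<phi> (j i) (ns i))"
  shows "entails \<Gamma> (\<lambda>i. j i (rlz P \<phi> (j i) (ns i)))"
  using entails_mp[OF entails_conjD1[OF agree_iff[OF assms(1-3), unfolded riff_def]] assms(4)] .

lemma agree_frc:
  assumes "agree P m \<phi>" "entails \<Gamma> (\<lambda>i. islop (j i))" "entails \<Gamma> (\<lambda>i. env m (ns i))"
    and "entails \<Gamma> (\<lambda>i. j i (rlz P \<phi> (j i) (ns i)))"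
  shows "entails \<Gamma> (\<lambda>i. frc P \<phi> (j i) (ns i))"
  using entails_mp[OF entails_conjD2[OF agree_iff[OF assms(1-3), unfolded riff_def]] assms(4)] .

section \<open>Agreement, connective by connective\<close>

lemma agree_Bot: "agree P m Bot"
  by (rule agreeI, unfold frc.simps rlz.simps) (rule entails_conj_snd)+

lemma agree_Eq:
  assumes "wf_tm m t"
  shows "agree P m (Eq t s)"
proof (rule agreeI, unfold frc.simps rlz.simps)
  let ?\<Gamma> = "\<lambda>x. islop (fst x) \<^bold>\<and> env m (snd x)"
  let ?E = "\<lambda>x. eqN (tm_val (snd x) t) (tm_val (snd x) s)"
  let ?R = "\<lambda>x. if tm_val (snd x) t = tm_val (snd x) s then UNIV else {}"
  show "entails (\<lambda>x. ?\<Gamma> x \<^bold>\<and> fst x (?E x)) (\<lambda>x. fst x (?R x))"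
  proof (rule islop_map[OF entails_weaken[OF entails_conj_fst] entails_conj_snd])
    show "entails (\<lambda>x. (?\<Gamma> x \<^bold>\<and> fst x (?E x)) \<^bold>\<and> ?E x) ?R"
      by (rule entails_trans[OF entails_conj_snd], rule entails_subset) (auto simp: eqN_def)
  qed
  show "entails (\<lambda>x. ?\<Gamma> x \<^bold>\<and> fst x (?R x)) (\<lambda>x. fst x (?E x))"
  proof (rule islop_map[OF entails_weaken[OF entails_conj_fst] entails_conj_snd])
    let ?\<Delta> = "\<lambda>x. (?\<Gamma> x \<^bold>\<and> fst x (?R x)) \<^bold>\<and> ?R x"
    \<comment> \<open>A true equation is realized by every number in \<open>rlz\<close>, but under
      \<open>eqN\<close> only by the common value of its sides, which is therefore computed from the
      environment.\<close>
    have "entails ?\<Delta> (\<lambda>x. {tm_val (snd x) t})"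
      by (rule entails_tm_val[OF assms entails_weaken[OF entails_weaken[OF entails_conj_snd]]])
    from entails_conjI[OF this entails_conj_snd]
    have "entails ?\<Delta> (\<lambda>x. {tm_val (snd x) t} \<^bold>\<and> ?R x)" .
    moreover have "entails (\<lambda>x. {tm_val (snd x) t} \<^bold>\<and> ?R x) ?E"
      by (rule entailsI[of _ _ CFst]) (auto simp: rconj_def eqN_def split: if_splits)
    ultimately show "entails ?\<Delta> ?E" by (rule entails_trans)
  qed
qed

lemma agree_And:
  assumes \<phi>: "agree P m \<phi>" and \<psi>: "agree P m \<psi>"
  shows "agree P m (And \<phi> \<psi>)"
proof (rule agreeI, unfold frc.simps rlz.simps)
  let ?\<Gamma> = "\<lambda>x. islop (fst x) \<^bold>\<and> env m (snd x)"
  let ?F = "\<lambda>\<phi> x. frc P \<phi> (fst x) (snd x)"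
  let ?R = "\<lambda>\<phi> x. rlz P \<phi> (fst x) (snd x)"
  let ?\<Delta> = "\<lambda>x. ?\<Gamma> x \<^bold>\<and> ?F \<phi> x \<^bold>\<and> ?F \<psi> x"
  have lop: "entails ?\<Delta> (\<lambda>x. islop (fst x))" and env: "entails ?\<Delta> (\<lambda>x. env m (snd x))"
    by (rule entails_weaken, rule entails_conj_fst entails_conj_snd)+
  have 1: "entails ?\<Delta> (\<lambda>x. fst x (?R \<phi> x))"
    by (rule agree_rlz[OF \<phi> lop env entails_conjD1[OF entails_conj_snd]])
  have 2: "entails ?\<Delta> (\<lambda>x. fst x (?R \<psi> x))"
    by (rule agree_rlz[OF \<psi> lop env entails_conjD2[OF entails_conj_snd]])
  \<comment> \<open>Two occurrences of the operator merge into one: the first conjunct is bound, the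
    second mapped.\<close>
  show "entails ?\<Delta> (\<lambda>x. fst x (?R \<phi> x \<^bold>\<and> ?R \<psi> x))"
    by (rule islop_bind[OF lop 1], rule islop_map[OF entails_weaken[OF lop] entails_weaken[OF 2]])
      (intro entails_conjI entails_conj_snd entails_weaken[OF entails_conj_snd])
  let ?\<Delta> = "\<lambda>x. ?\<Gamma> x \<^bold>\<and> fst x (?R \<phi> x \<^bold>\<and> ?R \<psi> x)"
  have lop: "entails ?\<Delta> (\<lambda>x. islop (fst x))" and env: "entails ?\<Delta> (\<lambda>x. env m (snd x))"
    by (rule entails_weaken, rule entails_conj_fst entails_conj_snd)+
  have 1: "entails ?\<Delta> (\<lambda>x. fst x (?R \<phi> x))"
    by (rule islop_map[OF lop entails_conj_snd entails_conjD1[OF entails_conj_snd]])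
  have 2: "entails ?\<Delta> (\<lambda>x. fst x (?R \<psi> x))"
    by (rule islop_map[OF lop entails_conj_snd entails_conjD2[OF entails_conj_snd]])
  show "entails ?\<Delta> (\<lambda>x. ?F \<phi> x \<^bold>\<and> ?F \<psi> x)"
    by (rule entails_conjI[OF agree_frc[OF \<phi> lop env 1] agree_frc[OF \<psi> lop env 2]])
qed

text \<open>From forcing, each disjunct becomes realizable only under \<open>j\<close>, hence a
  bind. Conversely the unit puts a realized disjunct under \<open>j\<close>, where its agreement
  applies, so a map suffices.\<close>

lemma agree_Or:
  assumes \<phi>: "agree P m \<phi>" and \<psi>: "agree P m \<psi>"
  shows "agree P m (Or \<phi> \<psi>)"
proof (rule agreeI, unfold frc.simps rlz.simps)
  let ?\<Gamma> = "\<lambda>x. islop (fst x) \<^bold>\<and> env m (snd x)"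
  let ?F = "\<lambda>\<phi> x. frc P \<phi> (fst x) (snd x)"
  let ?R = "\<lambda>\<phi> x. rlz P \<phi> (fst x) (snd x)"
  show "entails (\<lambda>x. ?\<Gamma> x \<^bold>\<and> fst x (?F \<phi> x \<^bold>\<or> ?F \<psi> x)) (\<lambda>x. fst x (?R \<phi> x \<^bold>\<or> ?R \<psi> x))"
  proof (rule islop_bind[OF entails_weaken[OF entails_conj_fst] entails_conj_snd],
      rule entails_disjE[OF entails_conj_snd])
    let ?\<Delta> = "\<lambda>x. ((?\<Gamma> x \<^bold>\<and> fst x (?F \<phi> x \<^bold>\<or> ?F \<psi> x)) \<^bold>\<and> (?F \<phi> x \<^bold>\<or> ?F \<psi> x))"
    have lop: "entails ?\<Delta> (\<lambda>x. islop (fst x))" and env: "entails ?\<Delta> (\<lambda>x. env m (snd x))"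
      by (rule entails_weaken, rule entails_weaken, rule entails_conj_fst entails_conj_snd)+
    show "entails (\<lambda>x. ?\<Delta> x \<^bold>\<and> ?F \<phi> x) (\<lambda>x. fst x (?R \<phi> x \<^bold>\<or> ?R \<psi> x))"
      by (rule islop_map[OF entails_weaken[OF lop] agree_rlz[OF \<phi> entails_weaken[OF lop]
              entails_weaken[OF env] entails_conj_snd] entails_disjI1[OF entails_conj_snd]])
    show "entails (\<lambda>x. ?\<Delta> x \<^bold>\<and> ?F \<psi> x) (\<lambda>x. fst x (?R \<phi> x \<^bold>\<or> ?R \<psi> x))"
      by (rule islop_map[OF entails_weaken[OF lop] agree_rlz[OF \<psi> entails_weaken[OF lop]
              entails_weaken[OF env] entails_conj_snd] entails_disjI2[OF entails_conj_snd]])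
  qed
  show "entails (\<lambda>x. ?\<Gamma> x \<^bold>\<and> fst x (?R \<phi> x \<^bold>\<or> ?R \<psi> x)) (\<lambda>x. fst x (?F \<phi> x \<^bold>\<or> ?F \<psi> x))"
  proof (rule islop_map[OF entails_weaken[OF entails_conj_fst] entails_conj_snd],
      rule entails_disjE[OF entails_conj_snd])
    let ?\<Delta> = "\<lambda>x. ((?\<Gamma> x \<^bold>\<and> fst x (?R \<phi> x \<^bold>\<or> ?R \<psi> x)) \<^bold>\<and> (?R \<phi> x \<^bold>\<or> ?R \<psi> x))"
    have lop: "entails ?\<Delta> (\<lambda>x. islop (fst x))" and env: "entails ?\<Delta> (\<lambda>x. env m (snd x))"
      by (rule entails_weaken, rule entails_weaken, rule entails_conj_fst entails_conj_snd)+
    show "entails (\<lambda>x. ?\<Delta> x \<^bold>\<and> ?R \<phi> x) (\<lambda>x. ?F \<phi> x \<^bold>\<or> ?F \<psi> x)"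
      by (rule entails_disjI1[OF agree_frc[OF \<phi> entails_weaken[OF lop] entails_weaken[OF env]
              islop_unit[OF entails_weaken[OF lop] entails_conj_snd]]])
    show "entails (\<lambda>x. ?\<Delta> x \<^bold>\<and> ?R \<psi> x) (\<lambda>x. ?F \<phi> x \<^bold>\<or> ?F \<psi> x)"
      by (rule entails_disjI2[OF agree_frc[OF \<psi> entails_weaken[OF lop] entails_weaken[OF env]
              islop_unit[OF entails_weaken[OF lop] entails_conj_snd]]])
  qed
qed

text \<open>As for disjunction; the witness \<open>n\<close> is its own realizer in
  \<open>{n}\<close> and extends the environment.\<close>

lemma agree_Ex:
  assumes \<phi>: "agree P (Suc m) \<phi>"
  shows "agree P m (Ex \<phi>)"
proof (rule agreeI, unfold frc.simps rlz.simps)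
  let ?\<Gamma> = "\<lambda>x. islop (fst x) \<^bold>\<and> env m (snd x)"
  let ?F = "\<lambda>x n. frc P \<phi> (fst x) (n # snd x)"
  let ?R = "\<lambda>x n. rlz P \<phi> (fst x) (n # snd x)"
  show "entails (\<lambda>x. ?\<Gamma> x \<^bold>\<and> fst x (\<Union>n. {n} \<^bold>\<and> ?F x n)) (\<lambda>x. fst x (\<Union>n. {n} \<^bold>\<and> ?R x n))"
  proof (rule islop_bind[OF entails_weaken[OF entails_conj_fst] entails_conj_snd],
      rule entails_UN_E[OF entails_conj_snd])
    let ?\<Delta> = "\<lambda>p. ((?\<Gamma> (fst p) \<^bold>\<and> fst (fst p) (\<Union>n. {n} \<^bold>\<and> ?F (fst p) n)) \<^bold>\<and>
      (\<Union>n. {n} \<^bold>\<and> ?F (fst p) n)) \<^bold>\<and> {snd p} \<^bold>\<and> ?F (fst p) (snd p)"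
    have lop: "entails ?\<Delta> (\<lambda>p. islop (fst (fst p)))" and env: "entails ?\<Delta> (\<lambda>p. env m (snd (fst p)))"
      by (rule entails_weaken, rule entails_weaken, rule entails_weaken,
          rule entails_conj_fst entails_conj_snd)+
    have n: "entails ?\<Delta> (\<lambda>p. {snd p})" by (rule entails_conjD1[OF entails_conj_snd])
    have "entails ?\<Delta> (\<lambda>p. fst (fst p) (?R (fst p) (snd p)))"
      by (rule agree_rlz[OF \<phi> lop entails_env_Cons[OF n env]], rule entails_conjD2[OF entails_conj_snd])
    then show "entails ?\<Delta> (\<lambda>p. fst (fst p) (\<Union>n. {n} \<^bold>\<and> ?R (fst p) n))"
      by (rule islop_map[OF lop])
        (rule entails_UN_I, rule entails_conjI[OF entails_weaken[OF n] entails_conj_snd])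
  qed
  show "entails (\<lambda>x. ?\<Gamma> x \<^bold>\<and> fst x (\<Union>n. {n} \<^bold>\<and> ?R x n)) (\<lambda>x. fst x (\<Union>n. {n} \<^bold>\<and> ?F x n))"
  proof (rule islop_map[OF entails_weaken[OF entails_conj_fst] entails_conj_snd],
      rule entails_UN_E[OF entails_conj_snd])
    let ?\<Delta> = "\<lambda>p. ((?\<Gamma> (fst p) \<^bold>\<and> fst (fst p) (\<Union>n. {n} \<^bold>\<and> ?R (fst p) n)) \<^bold>\<and>
      (\<Union>n. {n} \<^bold>\<and> ?R (fst p) n)) \<^bold>\<and> {snd p} \<^bold>\<and> ?R (fst p) (snd p)"
    have lop: "entails ?\<Delta> (\<lambda>p. islop (fst (fst p)))" and env: "entails ?\<Delta> (\<lambda>p. env m (snd (fst p)))"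
      by (rule entails_weaken, rule entails_weaken, rule entails_weaken,
          rule entails_conj_fst entails_conj_snd)+
    have n: "entails ?\<Delta> (\<lambda>p. {snd p})" by (rule entails_conjD1[OF entails_conj_snd])
    have "entails ?\<Delta> (\<lambda>p. ?F (fst p) (snd p))"
      by (rule agree_frc[OF \<phi> lop entails_env_Cons[OF n env]], rule islop_unit[OF lop],
          rule entails_conjD2[OF entails_conj_snd])
    with n have "entails ?\<Delta> (\<lambda>p. {snd p} \<^bold>\<and> ?F (fst p) (snd p))" by (rule entails_conjI)
    then show "entails ?\<Delta> (\<lambda>p. \<Union>n. {n} \<^bold>\<and> ?F (fst p) n)"
      by (rule entails_UN_I)
  qed
qed

text \<open>Forward, the unit supplies the outer \<open>j\<close>. Backward, everything is moved
  under the given \<open>k\<close>: the realizer of the implication along the order, the premise by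
  its agreement. Two binds under \<open>k\<close> then reach the conclusion.\<close>

lemma agree_Imp:
  assumes P: "lop_frame P" and \<phi>: "agree P m \<phi>" and \<psi>: "agree P m \<psi>"
  shows "agree P m (Imp \<phi> \<psi>)"
proof (rule agreeI, unfold frc.simps rlz.simps)
  let ?\<Gamma> = "\<lambda>x. islop (fst x) \<^bold>\<and> env m (snd x)"
  let ?F = "\<lambda>x. \<Inter>k. eqPOmega k k \<^bold>\<longrightarrow> P k \<^bold>\<longrightarrow> ole (fst x) k \<^bold>\<longrightarrow>
    frc P \<phi> k (snd x) \<^bold>\<longrightarrow> frc P \<psi> k (snd x)"
  let ?R = "\<lambda>x. \<Inter>k. (P k \<^bold>\<and> (fst x \<^bold>\<sqsubseteq> k) \<^bold>\<and> rlz P \<phi> k (snd x)) \<^bold>\<longrightarrow> k (rlz P \<psi> k (snd x))"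
  show "entails (\<lambda>x. ?\<Gamma> x \<^bold>\<and> ?F x) (\<lambda>x. fst x (?R x))"
  proof (rule islop_unit[OF entails_weaken[OF entails_conj_fst]], rule entails_INT_I, rule entails_impI)
    let ?\<Delta> = "\<lambda>p. (?\<Gamma> (fst p) \<^bold>\<and> ?F (fst p)) \<^bold>\<and>
      P (snd p) \<^bold>\<and> (fst (fst p) \<^bold>\<sqsubseteq> snd p) \<^bold>\<and> rlz P \<phi> (snd p) (snd (fst p))"
    have env: "entails ?\<Delta> (\<lambda>p. env m (snd (fst p)))"
      by (rule entails_weaken, rule entails_weaken, rule entails_conj_snd)
    have f: "entails ?\<Delta> (\<lambda>p. ?F (fst p))" by (rule entails_weaken, rule entails_conj_snd)
    have h: "entails ?\<Delta> (\<lambda>p. (fst (fst p) \<^bold>\<sqsubseteq> snd p) \<^bold>\<and> rlz P \<phi> (snd p) (snd (fst p)))"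
      by (rule entails_conjD2[OF entails_conj_snd])
    have pk: "entails ?\<Delta> (\<lambda>p. P (snd p))" by (rule entails_conjD1[OF entails_conj_snd])
    note lop = entails_islop[OF P pk]
    have "entails ?\<Delta> (\<lambda>p. frc P \<phi> (snd p) (snd (fst p)))"
      by (rule agree_frc[OF \<phi> lop env], rule islop_unit[OF lop entails_conjD2[OF h]])
    with frc_above_mp[OF P pk entails_conjD1[OF h] f]
    have "entails ?\<Delta> (\<lambda>p. frc P \<psi> (snd p) (snd (fst p)))" by (rule entails_mp)
    then show "entails ?\<Delta> (\<lambda>p. snd p (rlz P \<psi> (snd p) (snd (fst p))))"
      by (rule agree_rlz[OF \<psi> lop env])
  qed
  show "entails (\<lambda>x. ?\<Gamma> x \<^bold>\<and> fst x (?R x)) ?F"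
  proof (rule frc_above_I, rule entails_impI)
    let ?\<Delta> = "\<lambda>p. ((?\<Gamma> (fst p) \<^bold>\<and> fst (fst p) (?R (fst p))) \<^bold>\<and> P (snd p) \<^bold>\<and> (fst (fst p) \<^bold>\<sqsubseteq> snd p))
      \<^bold>\<and> frc P \<phi> (snd p) (snd (fst p))"
    have env: "entails ?\<Delta> (\<lambda>p. env m (snd (fst p)))"
      by (rule entails_weaken, rule entails_weaken, rule entails_weaken, rule entails_conj_snd)
    have r: "entails ?\<Delta> (\<lambda>p. fst (fst p) (?R (fst p)))"
      by (rule entails_weaken, rule entails_weaken, rule entails_conj_snd)
    have h: "entails ?\<Delta> (\<lambda>p. P (snd p) \<^bold>\<and> (fst (fst p) \<^bold>\<sqsubseteq> snd p))"
      by (rule entails_weaken, rule entails_conj_snd)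
    note pk = entails_conjD1[OF h] and jk = entails_conjD2[OF h]
    note lop = entails_islop[OF P pk]
    have kr: "entails ?\<Delta> (\<lambda>p. snd p (?R (fst p)))"
      by (rule entails_rsub_apply[OF jk r])
    have k\<phi>: "entails ?\<Delta> (\<lambda>p. snd p (rlz P \<phi> (snd p) (snd (fst p))))"
      by (rule agree_rlz[OF \<phi> lop env entails_conj_snd])
    let ?\<Theta> = "\<lambda>p. (?\<Delta> p \<^bold>\<and> ?R (fst p)) \<^bold>\<and> rlz P \<phi> (snd p) (snd (fst p))"
    have "entails ?\<Theta> (\<lambda>p. ?R (fst p))" by (rule entails_weaken[OF entails_conj_snd])
    from entails_INT_D[OF this, of snd]
    have "entails ?\<Theta> (\<lambda>p. snd p (rlz P \<psi> (snd p) (snd (fst p))))"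
      by (rule entails_mp) (intro entails_conjI entails_conj_snd entails_weaken[OF entails_weaken[OF pk]]
          entails_weaken[OF entails_weaken[OF jk]])
    from islop_bind[OF entails_weaken[OF lop] entails_weaken[OF k\<phi>] this]
    have "entails (\<lambda>p. ?\<Delta> p \<^bold>\<and> ?R (fst p)) (\<lambda>p. snd p (rlz P \<psi> (snd p) (snd (fst p))))" .
    from islop_bind[OF lop kr this]
    show "entails ?\<Delta> (\<lambda>p. frc P \<psi> (snd p) (snd (fst p)))"
      by (rule agree_frc[OF \<psi> lop env])
  qed
qed

text \<open>Like implication, but the number \<open>n\<close> is at hand without an operator in
  front, so one bind is enough.\<close>

lemma agree_All:
  assumes P: "lop_frame P" and \<phi>: "agree P (Suc m) \<phi>"
  shows "agree P m (All \<phi>)"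
proof (rule agreeI, unfold frc.simps rlz.simps)
  let ?\<Gamma> = "\<lambda>x. islop (fst x) \<^bold>\<and> env m (snd x)"
  let ?F = "\<lambda>x. \<Inter>k. eqPOmega k k \<^bold>\<longrightarrow> P k \<^bold>\<longrightarrow> ole (fst x) k \<^bold>\<longrightarrow>
    (\<Inter>n. {n} \<^bold>\<longrightarrow> frc P \<phi> k (n # snd x))"
  let ?R = "\<lambda>x. \<Inter>k. \<Inter>n. (P k \<^bold>\<and> (fst x \<^bold>\<sqsubseteq> k) \<^bold>\<and> {n}) \<^bold>\<longrightarrow> k (rlz P \<phi> k (n # snd x))"
  show "entails (\<lambda>x. ?\<Gamma> x \<^bold>\<and> ?F x) (\<lambda>x. fst x (?R x))"
  proof (rule islop_unit[OF entails_weaken[OF entails_conj_fst]], rule entails_INT_I,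
      rule entails_INT_I, rule entails_impI)
    let ?\<Delta> = "\<lambda>p. (?\<Gamma> (fst (fst p)) \<^bold>\<and> ?F (fst (fst p))) \<^bold>\<and>
      P (snd (fst p)) \<^bold>\<and> (fst (fst (fst p)) \<^bold>\<sqsubseteq> snd (fst p)) \<^bold>\<and> {snd p}"
    have env: "entails ?\<Delta> (\<lambda>p. env m (snd (fst (fst p))))"
      by (rule entails_weaken, rule entails_weaken, rule entails_conj_snd)
    have f: "entails ?\<Delta> (\<lambda>p. ?F (fst (fst p)))" by (rule entails_weaken, rule entails_conj_snd)
    have h: "entails ?\<Delta> (\<lambda>p. (fst (fst (fst p)) \<^bold>\<sqsubseteq> snd (fst p)) \<^bold>\<and> {snd p})"
      by (rule entails_conjD2[OF entails_conj_snd])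
    have pk: "entails ?\<Delta> (\<lambda>p. P (snd (fst p)))" by (rule entails_conjD1[OF entails_conj_snd])
    note lop = entails_islop[OF P pk] and n = entails_conjD2[OF h]
    from entails_INT_D[OF frc_above_mp[OF P pk entails_conjD1[OF h] f], of snd] n
    have "entails ?\<Delta> (\<lambda>p. frc P \<phi> (snd (fst p)) (snd p # snd (fst (fst p))))" by (rule entails_mp)
    then show "entails ?\<Delta> (\<lambda>p. snd (fst p) (rlz P \<phi> (snd (fst p)) (snd p # snd (fst (fst p)))))"
      by (rule agree_rlz[OF \<phi> lop entails_env_Cons[OF n env]])
  qed
  show "entails (\<lambda>x. ?\<Gamma> x \<^bold>\<and> fst x (?R x)) ?F"
  proof (rule frc_above_I, rule entails_INT_I, rule entails_impI)
    let ?\<Delta> = "\<lambda>p. ((?\<Gamma> (fst (fst p)) \<^bold>\<and> fst (fst (fst p)) (?R (fst (fst p)))) \<^bold>\<and>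
      P (snd (fst p)) \<^bold>\<and> (fst (fst (fst p)) \<^bold>\<sqsubseteq> snd (fst p))) \<^bold>\<and> {snd p}"
    have env: "entails ?\<Delta> (\<lambda>p. env m (snd (fst (fst p))))"
      by (rule entails_weaken, rule entails_weaken, rule entails_weaken, rule entails_conj_snd)
    have r: "entails ?\<Delta> (\<lambda>p. fst (fst (fst p)) (?R (fst (fst p))))"
      by (rule entails_weaken, rule entails_weaken, rule entails_conj_snd)
    have h: "entails ?\<Delta> (\<lambda>p. P (snd (fst p)) \<^bold>\<and> (fst (fst (fst p)) \<^bold>\<sqsubseteq> snd (fst p)))"
      by (rule entails_weaken, rule entails_conj_snd)
    have n: "entails ?\<Delta> (\<lambda>p. {snd p})" by (rule entails_conj_snd)
    note pk = entails_conjD1[OF h] and jk = entails_conjD2[OF h]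
    note lop = entails_islop[OF P pk]
    have kr: "entails ?\<Delta> (\<lambda>p. snd (fst p) (?R (fst (fst p))))"
      by (rule entails_rsub_apply[OF jk r])
    let ?\<Theta> = "\<lambda>p. ?\<Delta> p \<^bold>\<and> ?R (fst (fst p))"
    have "entails ?\<Theta> (\<lambda>p. ?R (fst (fst p)))" by (rule entails_conj_snd)
    from entails_INT_D[OF entails_INT_D[OF this, of "\<lambda>p. snd (fst p)"], of snd]
    have "entails ?\<Theta> (\<lambda>p. snd (fst p) (rlz P \<phi> (snd (fst p)) (snd p # snd (fst (fst p)))))"
      by (rule entails_mp)
        (intro entails_conjI entails_weaken[OF n] entails_weaken[OF pk] entails_weaken[OF jk])
    from islop_bind[OF lop kr this]
    show "entails ?\<Delta> (\<lambda>p. frc P \<phi> (snd (fst p)) (snd p # snd (fst (fst p))))"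
      by (rule agree_frc[OF \<phi> lop entails_env_Cons[OF n env]])
  qed
qed

lemma agree_wf: "lop_frame P \<Longrightarrow> wf_fm m \<phi> \<Longrightarrow> agree P m \<phi>"
  by (induction \<phi> arbitrary: m)
    (auto intro: agree_Bot agree_Eq agree_And agree_Or agree_Imp agree_All agree_Ex)

section \<open>Removing the outer operator in the non-degenerate case\<close>

lemma rimp_nonempty: "e \<in> (p \<^bold>\<longrightarrow> q) \<Longrightarrow> p \<noteq> {} \<Longrightarrow> q \<noteq> {}"
  unfolding rimp_def by blast

text \<open>The unit gives one direction. For the other, if \<open>j {}\<close> had an element,
  monotonicity along the uniformly realized implications from \<open>{}\<close> would yield a common
  element of all \<open>j q\<close>, and \<open>j\<close> would be equivalent to the constant
  \<open>UNIV\<close>.\<close>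

lemma local_operator_nonempty_iff:
  assumes "local_operator j" "nondegenerate j"
  shows "j p \<noteq> {} \<longleftrightarrow> p \<noteq> {}"
proof
  obtain a where a: "a \<in> islop j" using assms(1) unfolding local_operator_def by blast
  show "j p \<noteq> {}" if "p \<noteq> {}"
  proof -
    from that obtain b where "b \<in> p" by blast
    from islop_unit[OF entails_const[OF a] entails_const[OF this]]
    have "entails (\<lambda>_::unit. UNIV) (\<lambda>_. j p)" .
    then show ?thesis unfolding entails_def by blast
  qed
  show "p \<noteq> {}" if "j p \<noteq> {}"
  proof
    assume "p = {}"
    with that obtain x where "x \<in> j {}" by blast
    then have *: "entails (\<lambda>_. UNIV) (\<lambda>_. j {})" by (rule entails_const)
    have "entails (\<lambda>q. UNIV \<^bold>\<and> {}) (\<lambda>q. q)"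
      by (rule entails_trans[OF entails_conj_snd], rule entails_subset) simp
    from islop_map[OF entails_const[OF a] * this] have j: "entails (\<lambda>_. UNIV) j" .
    have "entails (\<lambda>_::unit. UNIV) (\<lambda>_. j \<^bold>\<equiv> (\<lambda>_. UNIV))"
      unfolding req_def
    proof (rule entails_INT_I, rule entails_iffI)
      show "entails (\<lambda>p::unit \<times> nat set. UNIV \<^bold>\<and> j (snd p)) (\<lambda>p. UNIV)"
        by (rule entails_subset) simp
      show "entails (\<lambda>p::unit \<times> nat set. UNIV \<^bold>\<and> UNIV) (\<lambda>p. j (snd p))"
        by (rule entails_weaken, rule entails_subst[OF j])
    qed
    then have "(j \<^bold>\<equiv> (\<lambda>_. UNIV)) \<noteq> {}" unfolding entails_def by blast
    with assms(2) show False unfolding nondegenerate_def by simp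
  qed
qed

theorem theorem5p10:
  fixes P :: frame and j :: lop and \<phi> :: fm and ns :: "nat list"
  assumes "lop_frame P"
    and "local_operator j" and "nondegenerate j"
    and "wf_fm (length ns) \<phi>"
  shows "Eff_models (forces P (POConst j) (subst_numerals \<phi> ns)) \<longleftrightarrow> rlz P \<phi> j ns \<noteq> {}"
proof -
  have "entails (\<lambda>x. islop (fst x) \<^bold>\<and> env (length ns) (snd x))
     (\<lambda>x. frc P \<phi> (fst x) (snd x) \<^bold>\<longleftrightarrow> fst x (rlz P \<phi> (fst x) (snd x)))"
    using agree_wf[OF assms(1,4)] unfolding agree_def .
  \<comment> \<open>The uniform code is used at the index \<open>(j, ns)\<close>, where the context
    is inhabited.\<close>
  moreover have "(islop j \<^bold>\<and> env (length ns) ns) \<noteq> {}"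
    using assms(2) by (auto simp: local_operator_def env_def rconj_def)
  ultimately have "(frc P \<phi> j ns \<^bold>\<longleftrightarrow> j (rlz P \<phi> j ns)) \<noteq> {}"
    by (auto simp: entails_def)
  then have "frc P \<phi> j ns \<noteq> {} \<longleftrightarrow> j (rlz P \<phi> j ns) \<noteq> {}"
    unfolding riff_def rconj_def using rimp_nonempty by blast
  also have "\<dots> \<longleftrightarrow> rlz P \<phi> j ns \<noteq> {}"
    by (rule local_operator_nonempty_iff[OF assms(2,3)])
  \<comment> \<open>\<open>frc_inst\<close> enters with \<open>d = 0\<close> and
    \<open>ms = []\<close>, so that the sentence with numerals is evaluated as \<open>\<phi>\<close>
    in the environment \<open>ns\<close>.\<close>
  finally show ?thesis
    by (simp add: Eff_models_def interp_forces frc_inst)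
qed

end
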